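(* Let $G$ be a finite connected loopless graph (multiple edges allowed) of genus $g=|E(G)|-|V(G)|+1$ and let $q\in V(G)$. Let $\mathcal{A}$ be a dissecting external atlas of $G$ and let $\mathcal{A}^\ast=\mathcal{A}^\ast_{\sigma^\ast}$ be the internal atlas of a triangulating cocycle signature $\sigma^\ast$. For $T\in\mathcal{ST}(G)$ let $\vec{T}\in\mathcal{A}$ and $\vec{T^\ast}\in\mathcal{A}^\ast_{\sigma^\ast}$ be the corresponding externally and internally oriented versions of $T$. Define $$I_G^{\sigma^\ast}:\mathcal{ST}(G)\to\mathrm{Div}^0(G),\qquad T\mapsto D_{-(\vec{T^\ast})^c}+(q).$$ Then the divisors $D_{\vec{T}\cap\vec{T^\ast}}+(q)$, $T\in\mathcal{ST}(G)$, are pairwise linearly inequivalent (for distinct $T$), one has $$\{D_{\vec{T}\cap\vec{T^\ast}}+(q)\;:\;T\in\mathcal{ST}(G)\}=\mathcal{BD}_{I_G^{\sigma^\ast}}(G),$$ and $\mathcal{BD}_{I_G^{\sigma^\ast}}(G)$ is a complete set of chip-firing representatives; that is, every divisor of degree $g$ on $G$ is linearly equivalent to exactly one element of it.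
   Context: $\mathcal{ST}(G)$ is the set of spanning trees of $G$. A divisor on $G$ is a function $D:V(G)\to\mathbb{Z}$; its degree is $\sum_v D(v)$; $\mathrm{Div}^d(G)$ is the set of divisors of degree $d$; $(q)$ is the divisor with value $1$ at $q$ and $0$ elsewhere. Two divisors are linearly equivalent if one is obtained from the other by a sequence of chip-firing moves (firing at $v$: $v$ sends one chip along each incident edge to the other endpoint; borrowing is the inverse). An arc is an oriented edge. A fourientation of $G$ is a subset of the set of all arcs, so each edge is unoriented, one-way oriented, or bioriented. For a fourientation $\vec F$, $-\vec F$ reverses all one-way oriented edges, and $\vec F^c$ (set complement) reverses one-way oriented edges and interchanges unoriented and bioriented edges. For a fourientation $\vec F$ without bioriented edges, $D_{\vec F}(v)=\mathrm{indeg}_{\vec F}(v)-1$, where $\mathrm{indeg}_{\vec F}(v)$ counts the one-way oriented edges pointing to $v$. An externally (resp. internally) oriented spanning tree $\vec T$ (resp. $\vec{T^\ast}$) is a fourientation in which every edge in $T$ (resp. not in $T$) is bioriented and every edge not in $T$ (resp. in $T$) is one-way oriented. An external (resp. internal) atlas is a choice of one externally (resp. internally) oriented version of each $T\in\mathcal{ST}(G)$. Thus $\vec T\cap\vec{T^\ast}$ (intersection of arc sets) is an orientation of $G$, and $-(\vec{T^\ast})^c$ has the edges of $T$ oriented as in $\vec{T^\ast}$ and all other edges unoriented. A cocycle $C^\ast$ is an inclusion-minimal edge cut $E(W,W^c)$ with $G[W]$, $G[W^c]$ connected and $W,W^c\neq\emptyset$; a signed cocycle $\vec{C^\ast}$ is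 $C^\ast$ with all edges oriented from $W$ to $W^c$, or all from $W^c$ to $W$. A cocycle signature $\sigma^\ast$ chooses one signed cocycle $\sigma^\ast(C^\ast)$ for each $C^\ast$. For $e\in T$, the fundamental cocycle $C^\ast(T,e)$ is the set of edges joining the two components of $T\setminus e$. The internal atlas $\mathcal{A}^\ast_{\sigma^\ast}$ orients each $e\in T$ as in $\sigma^\ast(C^\ast(T,e))$. The signature $\sigma^\ast$ is triangulating if for every $\vec{T^\ast}\in\mathcal{A}^\ast_{\sigma^\ast}$ and every signed cocycle $\vec{C^\ast}\subseteq\vec{T^\ast}$, one has $\vec{C^\ast}=\sigma^\ast(C^\ast)$. Dissecting external atlas: fix a reference orientation of $G$, with reference arcs $\vec e_1,\dots,\vec e_n$ ($n=|E(G)|$), and let $M$ be a totally unimodular $r\times n$ matrix, $r=|V(G)|-1$, representing the graphic matroid and whose row space equals that of the signed incidence matrix of the reference orientation. The Lawrence polytope $\mathcal{P}\subset\mathbb{R}^{n+r}$ is the convex hull of the columns $P_1,\dots,P_n,P_{-1},\dots,P_{-n}$ of $\begin{pmatrix}M&\mathbf 0\\ I_n&I_n\end{pmatrix}$; these are exactly its vertices. A dissection of $\mathcal{P}$ is a collection of maximal(-dimensional) simplices with vertices among the $P_{\pm i}$, whose union is $\mathcal{P}$ and any two distinct of which have disjoint relative interiors. To a maximal simplex $\tau$ associate the fourientation $\{\vec e_i: P_i\in\tau\}\cup\{-\vec e_i:P_{-i}\in\tau\}$, which is an externally oriented spanning tree. An external atlas is dissecting if it is the image of the set of simplices of some dissection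 of $\mathcal{P}$ under this correspondence. For $T\in\mathcal{ST}(G)$ and an orientation $\mathcal{O}_{\mathcal{E}_T}$ of the edges $\mathcal{E}_T=E(G)\setminus T$, the break divisor $\mathcal{D}(T,\mathcal{O}_{\mathcal{E}_T})\in\mathrm{Div}^g(G)$ places one chip at the head of each oriented edge. For $I:\mathcal{ST}(G)\to\mathrm{Div}^0(G)$, $\mathcal{BD}_I(G)=\{\mathcal{D}(T,\mathcal{O}_{\mathcal{E}_T})+I(T)\}$, over all $T$ and all orientations $\mathcal{O}_{\mathcal{E}_T}$ of $\mathcal{E}_T$. *)

theory Defs
  imports "HOL-Analysis.Analysis" "Jordan_Normal_Form.Determinant"
begin

(* HOL-Analysis keeps the short names and the infix $; the Jordan_Normal_Form library is
   used only for determinants of matrices whose size is a natural number. *)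
no_notation Matrix.vec_index (infixl "$" 100)
no_notation Matrix.scalar_prod (infix "\<bullet>" 70)
hide_const (open) Matrix.row Matrix.rows Matrix.vec Matrix.mat Determinant.det Matrix.transpose_mat
  Matrix.scalar_prod Matrix.vec_index Matrix.dim_vec

section \<open>Finite loopless multigraphs\<close>

text \<open>
  The vertex set is the whole (finite, nonempty) type of vertices.  The edge set is a subset of the
  edge type, so that the graph with one vertex and no edge is not excluded.
\<close>

record ('v, 'e) multigraph =
  edges :: "'e set"
  ends :: "'e \<Rightarrow> 'v set"

definition loopless :: "('v, 'e) multigraph \<Rightarrow> bool" where
  "loopless G \<longleftrightarrow> (\<forall>e\<in>edges G. card (ends G e) = 2)"

definition adj :: "('v, 'e) multigraph \<Rightarrow> 'e set \<Rightarrow> ('v \<times> 'v) set" where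
  "adj G F = {(u, v). \<exists>e\<in>F. ends G e = {u, v}}"

definition connected_by :: "('v, 'e) multigraph \<Rightarrow> 'v set \<Rightarrow> 'e set \<Rightarrow> bool" where
  "connected_by G W F \<longleftrightarrow> W \<noteq> {} \<and> (\<forall>u\<in>W. \<forall>v\<in>W. (u, v) \<in> (adj G F)\<^sup>*)"

definition connected_graph :: "('v, 'e) multigraph \<Rightarrow> bool" where
  "connected_graph G \<longleftrightarrow> connected_by G UNIV (edges G)"

definition induced_connected :: "('v, 'e) multigraph \<Rightarrow> 'v set \<Rightarrow> bool" where
  "induced_connected G W \<longleftrightarrow> connected_by G W {e \<in> edges G. ends G e \<subseteq> W}"

definition genus :: "('v::finite, 'e) multigraph \<Rightarrow> int" where
  "genus G = int (card (edges G)) - int CARD('v) + 1"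

text \<open>Two parallel edges form a cycle of length 2; hence the edges are required to be distinct, too.\<close>

definition is_cycle :: "('v, 'e) multigraph \<Rightarrow> 'v list \<Rightarrow> 'e list \<Rightarrow> bool" where
  "is_cycle G vs es \<longleftrightarrow> es \<noteq> [] \<and> length vs = length es \<and> distinct vs \<and> distinct es \<and>
     set es \<subseteq> edges G \<and>
     (\<forall>i < length es. ends G (es ! i) = {vs ! i, vs ! (Suc i mod length vs)})"

definition forest :: "('v, 'e) multigraph \<Rightarrow> 'e set \<Rightarrow> bool" where
  "forest G F \<longleftrightarrow> \<not> (\<exists>vs es. is_cycle G vs es \<and> set es \<subseteq> F)"

definition spanning_trees :: "('v, 'e) multigraph \<Rightarrow> 'e set set" where
  "spanning_trees G = {T. T \<subseteq> edges G \<and> connected_by G UNIV T \<and> forest G T}"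

section \<open>Arcs and fourientations\<close>

text \<open>The arc \<open>(e, u, v)\<close> is the edge \<open>e\<close> oriented from \<open>u\<close> to \<open>v\<close>.\<close>

type_synonym ('v, 'e) arc = "'e \<times> 'v \<times> 'v"

definition arc_edge :: "('v, 'e) arc \<Rightarrow> 'e" where "arc_edge a = fst a"
definition arc_tail :: "('v, 'e) arc \<Rightarrow> 'v" where "arc_tail a = fst (snd a)"
definition arc_head :: "('v, 'e) arc \<Rightarrow> 'v" where "arc_head a = snd (snd a)"

definition arc_rev :: "('v, 'e) arc \<Rightarrow> ('v, 'e) arc" where
  "arc_rev a = (arc_edge a, arc_head a, arc_tail a)"

definition arcs :: "('v, 'e) multigraph \<Rightarrow> ('v, 'e) arc set" where
  "arcs G = {a. arc_edge a \<in> edges G \<and> ends G (arc_edge a) = {arc_tail a, arc_head a}}"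

definition fourientation :: "('v, 'e) multigraph \<Rightarrow> ('v, 'e) arc set \<Rightarrow> bool" where
  "fourientation G F \<longleftrightarrow> F \<subseteq> arcs G"

definition bioriented :: "('v, 'e) multigraph \<Rightarrow> ('v, 'e) arc set \<Rightarrow> 'e \<Rightarrow> bool" where
  "bioriented G F e \<longleftrightarrow> (\<forall>a\<in>arcs G. arc_edge a = e \<longrightarrow> a \<in> F)"

definition one_way :: "('v, 'e) arc set \<Rightarrow> 'e \<Rightarrow> bool" where
  "one_way F e \<longleftrightarrow> (\<exists>!a. a \<in> F \<and> arc_edge a = e)"

text \<open>Reversing all arcs leaves the unoriented and the bioriented edges unchanged.\<close>

definition fourientation_neg :: "('v, 'e) arc set \<Rightarrow> ('v, 'e) arc set" where
  "fourientation_neg F = arc_rev ` F"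

definition fourientation_compl :: "('v, 'e) multigraph \<Rightarrow> ('v, 'e) arc set \<Rightarrow> ('v, 'e) arc set" where
  "fourientation_compl G F = arcs G - F"

section \<open>Divisors and chip-firing\<close>

type_synonym 'v divisor = "'v \<Rightarrow> int"

definition degree_div :: "('v::finite) divisor \<Rightarrow> int" where
  "degree_div D = (\<Sum>v\<in>UNIV. D v)"

definition Div :: "int \<Rightarrow> ('v::finite) divisor set" where
  "Div d = {D. degree_div D = d}"

definition chip :: "'v \<Rightarrow> 'v divisor" where
  "chip q = (\<lambda>v. if v = q then 1 else 0)"

definition div_plus :: "'v divisor \<Rightarrow> 'v divisor \<Rightarrow> 'v divisor" (infixl "\<oplus>\<^sub>D" 65) where
  "D \<oplus>\<^sub>D D' = (\<lambda>v. D v + D' v)"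

definition fire :: "('v, 'e) multigraph \<Rightarrow> 'v \<Rightarrow> 'v divisor \<Rightarrow> 'v divisor" where
  "fire G v D = (\<lambda>w. D w + int (card {a \<in> arcs G. arc_tail a = v \<and> arc_head a = w})
                     - (if w = v then int (card {a \<in> arcs G. arc_tail a = v}) else 0))"

definition linearly_equivalent :: "('v, 'e) multigraph \<Rightarrow> 'v divisor \<Rightarrow> 'v divisor \<Rightarrow> bool" where
  "linearly_equivalent G = (\<lambda>D D'. \<exists>v. D' = fire G v D \<or> D = fire G v D')\<^sup>*\<^sup>*"

definition complete_representatives ::
    "('v::finite, 'e) multigraph \<Rightarrow> int \<Rightarrow> 'v divisor set \<Rightarrow> bool" where
  "complete_representatives G d S \<longleftrightarrow>
     S \<subseteq> Div d \<and> (\<forall>D\<in>Div d. \<exists>!D'. D' \<in> S \<and> linearly_equivalent G D D')"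

definition indeg :: "('v, 'e) arc set \<Rightarrow> 'v \<Rightarrow> nat" where
  "indeg F v = card {a \<in> F. arc_head a = v \<and> one_way F (arc_edge a)}"

definition fourientation_div :: "('v, 'e) arc set \<Rightarrow> 'v divisor" where
  "fourientation_div F = (\<lambda>v. int (indeg F v) - 1)"

section \<open>Atlases\<close>

definition externally_oriented ::
    "('v, 'e) multigraph \<Rightarrow> 'e set \<Rightarrow> ('v, 'e) arc set \<Rightarrow> bool" where
  "externally_oriented G T F \<longleftrightarrow> fourientation G F \<and>
     (\<forall>e\<in>T. bioriented G F e) \<and> (\<forall>e\<in>edges G - T. one_way F e)"

text \<open>An atlas is given as the function that sends each spanning tree to its oriented version.\<close>

definition external_atlas ::
    "('v, 'e) multigraph \<Rightarrow> ('e set \<Rightarrow> ('v, 'e) arc set) \<Rightarrow> bool" where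
  "external_atlas G A \<longleftrightarrow> (\<forall>T\<in>spanning_trees G. externally_oriented G T (A T))"

section \<open>Cocycles and cocycle signatures\<close>

definition edge_cut :: "('v, 'e) multigraph \<Rightarrow> 'v set \<Rightarrow> 'e set" where
  "edge_cut G W = {e \<in> edges G. ends G e \<inter> W \<noteq> {} \<and> ends G e \<inter> - W \<noteq> {}}"

definition cocycle_side :: "('v, 'e) multigraph \<Rightarrow> 'v set \<Rightarrow> bool" where
  "cocycle_side G W \<longleftrightarrow> W \<noteq> {} \<and> - W \<noteq> {} \<and>
     induced_connected G W \<and> induced_connected G (- W) \<and>
     (\<forall>U. U \<noteq> {} \<and> - U \<noteq> {} \<and> edge_cut G U \<subseteq> edge_cut G W \<longrightarrow> edge_cut G U = edge_cut G W)"

definition cocycles :: "('v, 'e) multigraph \<Rightarrow> 'e set set" where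
  "cocycles G = {edge_cut G W | W. cocycle_side G W}"

text \<open>
  Both signed versions of a cocycle are covered, since \<open>W\<close> may be replaced by its complement.
\<close>

definition signed_cocycles :: "('v, 'e) multigraph \<Rightarrow> ('v, 'e) arc set set" where
  "signed_cocycles G = {{a \<in> arcs G. arc_tail a \<in> W \<and> arc_head a \<in> - W} | W. cocycle_side G W}"

definition cocycle_signature ::
    "('v, 'e) multigraph \<Rightarrow> ('e set \<Rightarrow> ('v, 'e) arc set) \<Rightarrow> bool" where
  "cocycle_signature G \<sigma> \<longleftrightarrow>
     (\<forall>C\<in>cocycles G. \<sigma> C \<in> signed_cocycles G \<and> arc_edge ` \<sigma> C = C)"

definition fundamental_cocycle :: "('v, 'e) multigraph \<Rightarrow> 'e set \<Rightarrow> 'e \<Rightarrow> 'e set" where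
  "fundamental_cocycle G T e =
     {f \<in> edges G. \<exists>u v. ends G f = {u, v} \<and> (u, v) \<notin> (adj G (T - {e}))\<^sup>*}"

definition internal_atlas_of ::
    "('v, 'e) multigraph \<Rightarrow> ('e set \<Rightarrow> ('v, 'e) arc set) \<Rightarrow> 'e set \<Rightarrow> ('v, 'e) arc set" where
  "internal_atlas_of G \<sigma> T =
     {a \<in> arcs G. arc_edge a \<in> T \<longrightarrow> a \<in> \<sigma> (fundamental_cocycle G T (arc_edge a))}"

definition triangulating ::
    "('v, 'e) multigraph \<Rightarrow> ('e set \<Rightarrow> ('v, 'e) arc set) \<Rightarrow> bool" where
  "triangulating G \<sigma> \<longleftrightarrow>
     (\<forall>T\<in>spanning_trees G. \<forall>C\<in>signed_cocycles G.
        C \<subseteq> internal_atlas_of G \<sigma> T \<longrightarrow> C = \<sigma> (arc_edge ` C))"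

section \<open>The Lawrence polytope and dissecting external atlases\<close>

definition reference_orientation ::
    "('v, 'e) multigraph \<Rightarrow> ('e \<Rightarrow> ('v, 'e) arc) \<Rightarrow> bool" where
  "reference_orientation G ref \<longleftrightarrow> (\<forall>e\<in>edges G. ref e \<in> arcs G \<and> arc_edge (ref e) = e)"

definition incidence_matrix ::
    "('v::finite, 'e::finite) multigraph \<Rightarrow> ('e \<Rightarrow> ('v, 'e) arc) \<Rightarrow> real^'e^'v" where
  "incidence_matrix G ref =
     (\<chi> v e. if e \<in> edges G
              then (if v = arc_head (ref e) then 1 else 0) - (if v = arc_tail (ref e) then 1 else 0)
              else 0)"

definition totally_unimodular :: "real^'n::finite^'m::finite \<Rightarrow> bool" where
  "totally_unimodular M \<longleftrightarrow>
     (\<forall>rs cs. distinct rs \<and> distinct cs \<and> length rs = length cs \<longrightarrow>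
        Determinant.det (Matrix.mat (length rs) (length cs) (\<lambda>(i, j). M $ (rs ! i) $ (cs ! j)))
          \<in> {-1, 0, 1})"

text \<open>Parallel edges may have equal columns; such a family of columns is linearly dependent.\<close>

definition represents_graphic_matroid ::
    "('v, 'e::finite) multigraph \<Rightarrow> real^'e^'r::finite \<Rightarrow> bool" where
  "represents_graphic_matroid G M \<longleftrightarrow>
     (\<forall>F \<subseteq> edges G. inj_on (\<lambda>e. column e M) F \<and> independent ((\<lambda>e. column e M) ` F) \<longleftrightarrow> forest G F)"

text \<open>
  An \<open>r \<times> n\<close> matrix is a matrix whose rows are indexed by an \<open>r\<close>-element set \<open>R\<close> and whose columns
  are indexed by the edges.  It is padded with zeros outside \<open>R\<close> and \<open>edges G\<close> (types are nonempty,
  but \<open>r = n = 0\<close> for the graph with one vertex); this does not affect the row space or total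
  unimodularity, and it embeds \<open>\<real>\<^sup>n\<^sup>+\<^sup>r\<close> below as a coordinate subspace.
\<close>

definition lawrence_matrix :: "('v::finite, 'e::finite) multigraph \<Rightarrow> ('e \<Rightarrow> ('v, 'e) arc) \<Rightarrow>
    'r::finite set \<Rightarrow> real^'e^'r \<Rightarrow> bool" where
  "lawrence_matrix G ref R M \<longleftrightarrow>
     card R = CARD('v) - 1 \<and>
     (\<forall>i e. i \<notin> R \<or> e \<notin> edges G \<longrightarrow> M $ i $ e = 0) \<and>
     totally_unimodular M \<and>
     represents_graphic_matroid G M \<and>
     span (rows M) = span (rows (incidence_matrix G ref))"

definition lawrence_pos :: "real^'e^'r \<Rightarrow> 'e \<Rightarrow> real^('r::finite + 'e::finite)" where
  "lawrence_pos M e = (\<chi> k. case k of Inl i \<Rightarrow> M $ i $ e | Inr f \<Rightarrow> if f = e then 1 else 0)"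

definition lawrence_neg :: "real^'e^'r \<Rightarrow> 'e \<Rightarrow> real^('r::finite + 'e::finite)" where
  "lawrence_neg M e = (\<chi> k. case k of Inl i \<Rightarrow> 0 | Inr f \<Rightarrow> if f = e then 1 else 0)"

definition lawrence_points ::
    "('v, 'e::finite) multigraph \<Rightarrow> real^'e^'r \<Rightarrow> (real^('r::finite + 'e)) set" where
  "lawrence_points G M = lawrence_pos M ` edges G \<union> lawrence_neg M ` edges G"

definition lawrence_polytope ::
    "('v, 'e::finite) multigraph \<Rightarrow> real^'e^'r \<Rightarrow> (real^('r::finite + 'e)) set" where
  "lawrence_polytope G M = convex hull (lawrence_points G M)"

definition maximal_simplex ::
    "('v, 'e::finite) multigraph \<Rightarrow> real^'e^'r \<Rightarrow> (real^('r::finite + 'e)) set \<Rightarrow> bool" where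
  "maximal_simplex G M S \<longleftrightarrow>
     aff_dim (lawrence_polytope G M) simplex S \<and>
     (\<forall>x. x extreme_point_of S \<longrightarrow> x \<in> lawrence_points G M)"

definition dissection ::
    "('v, 'e::finite) multigraph \<Rightarrow> real^'e^'r \<Rightarrow> (real^('r::finite + 'e)) set set \<Rightarrow> bool" where
  "dissection G M \<Delta> \<longleftrightarrow>
     (\<forall>S\<in>\<Delta>. maximal_simplex G M S) \<and>
     \<Union>\<Delta> = lawrence_polytope G M \<and>
     pairwise (\<lambda>S S'. rel_interior S \<inter> rel_interior S' = {}) \<Delta>"

definition simplex_fourientation :: "('v, 'e::finite) multigraph \<Rightarrow> ('e \<Rightarrow> ('v, 'e) arc) \<Rightarrow>
    real^'e^'r::finite \<Rightarrow> (real^('r + 'e)) set \<Rightarrow> ('v, 'e) arc set" where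
  "simplex_fourientation G ref M S =
     {ref e | e. e \<in> edges G \<and> lawrence_pos M e \<in> S} \<union>
     {arc_rev (ref e) | e. e \<in> edges G \<and> lawrence_neg M e \<in> S}"

definition dissecting :: "('v, 'e::finite) multigraph \<Rightarrow> ('e \<Rightarrow> ('v, 'e) arc) \<Rightarrow>
    real^'e^'r::finite \<Rightarrow> ('e set \<Rightarrow> ('v, 'e) arc set) \<Rightarrow> bool" where
  "dissecting G ref M A \<longleftrightarrow>
     (\<exists>\<Delta>. dissection G M \<Delta> \<and> A ` spanning_trees G = simplex_fourientation G ref M ` \<Delta>)"

section \<open>Generalized break divisors\<close>

definition orientation_of ::
    "('v, 'e) multigraph \<Rightarrow> 'e set \<Rightarrow> ('v, 'e) arc set \<Rightarrow> bool" where
  "orientation_of G S Ori \<longleftrightarrow> Ori \<subseteq> arcs G \<and> arc_edge ` Ori \<subseteq> S \<and> (\<forall>e\<in>S. one_way Ori e)"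

definition break_div :: "('v, 'e) arc set \<Rightarrow> 'v divisor" where
  "break_div Ori = (\<lambda>v. int (card {a \<in> Ori. arc_head a = v}))"

definition BD :: "('v, 'e) multigraph \<Rightarrow> ('e set \<Rightarrow> 'v divisor) \<Rightarrow> 'v divisor set" where
  "BD G I = {break_div Ori \<oplus>\<^sub>D I T | T Ori. T \<in> spanning_trees G \<and> orientation_of G (edges G - T) Ori}"

definition I_sig :: "('v, 'e) multigraph \<Rightarrow> 'v \<Rightarrow> ('e set \<Rightarrow> ('v, 'e) arc set) \<Rightarrow> 'e set \<Rightarrow> 'v divisor" where
  "I_sig G q \<sigma> T =
     fourientation_div (fourientation_neg (fourientation_compl G (internal_atlas_of G \<sigma> T)))
       \<oplus>\<^sub>D chip q"

end

theory Submission
  imports Defs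
begin

text \<open>
  Every nonempty directed cut contains a directed cocycle; hence, for a triangulating signature, the
  internally oriented versions of two trees cannot contain the two opposite directions of a cut.

  The elements of \<open>BD\<close> are the indegree divisors of the orientations contained in some internally
  oriented tree.  If two of them are linearly equivalent but distinct, the maximal level set of the
  firing script is a cut directed one way in the first orientation and the other way in the second one,
  which is impossible; so linear equivalence on \<open>BD\<close> is equality.

  Suppose that \<open>D T1 = D T2\<close>.  Consider the tree arcs of \<open>T1\<close> and the reversed tree arcs of \<open>T2\<close>.  If
  they do not form a strongly connected digraph, a closed vertex set gives a cut that is excluded as
  above.  Otherwise they carry a positive circulation, and moving along it from the common lattice
  point leads to a common interior point of the two simplices of the dissection; so \<open>T1 = T2\<close>.

  Finally, by Dhar's burning algorithm there are at most as many reduced divisors of a given degree as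
  spanning trees, so the inequivalent divisors \<open>D T\<close> exhaust all classes, and then also \<open>BD\<close>.
\<close>

section \<open>Arcs, connectivity and trees\<close>

text \<open>The passage to a common interior point is the Cayley trick. Weight the arcs so that the
  two arcs of each edge sum to 1. The resulting point of the scaled Lawrence polytope depends only
  on the inflow at each vertex, because \<open>M\<close> and the incidence matrix have the same
  kernel. In this slice the cell of a tree is a parallelepiped: tree edges have free weights between
  0 and 1, the other edges are fixed by the external atlas. The internal atlas selects one corner of
  the cell, and moving weight from the tree arcs to their reversals leads from this corner into the
  cell. Two cells with the same corner therefore overlap as soon as a positive combination of the
  tree arcs of T1 has the same boundary as one of the tree arcs of T2, which is a positive
  circulation on the arcs of T1 and the reversed arcs of T2. Strong connectivity versus a one-way
  cut is thus the alternative between overlapping cells and a violation of the triangulating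
  property.\<close>

definition cut_in :: "('v, 'e) multigraph \<Rightarrow> 'v set \<Rightarrow> ('v, 'e) arc set" where
  "cut_in G W = {a \<in> arcs G. arc_tail a \<notin> W \<and> arc_head a \<in> W}"

lemma arc_rev_simps [simp]:
  "arc_edge (arc_rev a) = arc_edge a" "arc_tail (arc_rev a) = arc_head a"
  "arc_head (arc_rev a) = arc_tail a" "arc_rev (arc_rev a) = a"
  by (auto simp: arc_rev_def arc_edge_def arc_tail_def arc_head_def)

lemma arc_eqI: "arc_edge a = arc_edge b \<Longrightarrow> arc_tail a = arc_tail b \<Longrightarrow> arc_head a = arc_head b \<Longrightarrow> a = b"
  by (auto simp: arc_edge_def arc_tail_def arc_head_def prod_eq_iff)

lemma arc_proj [simp]: "arc_edge (e, u, v) = e" "arc_tail (e, u, v) = u" "arc_head (e, u, v) = v"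
  by (auto simp: arc_edge_def arc_tail_def arc_head_def)

lemma arc_rev_in_arcs [simp]: "arc_rev a \<in> arcs G \<longleftrightarrow> a \<in> arcs G"
  by (auto simp: arcs_def insert_commute)

lemma arc_rev_image_iff [simp]: "a \<in> arc_rev ` F \<longleftrightarrow> arc_rev a \<in> F"
  by (metis arc_rev_simps(4) image_iff)

lemma inj_arc_rev: "inj_on arc_rev F"
  by (metis arc_rev_simps(4) inj_onI)

lemma arc_edge_in_edges: "a \<in> arcs G \<Longrightarrow> arc_edge a \<in> edges G"
  by (auto simp: arcs_def)

lemma adjI: "a \<in> arcs G \<Longrightarrow> arc_edge a \<in> F \<Longrightarrow> (arc_tail a, arc_head a) \<in> adj G F"
  by (auto simp: arcs_def adj_def)

lemma adjE:
  assumes "(u, v) \<in> adj G F" "F \<subseteq> edges G"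
  obtains a where "a \<in> arcs G" "arc_edge a \<in> F" "arc_tail a = u" "arc_head a = v"
proof -
  from assms obtain e where e: "e \<in> F" "ends G e = {u, v}" by (auto simp: adj_def)
  show ?thesis by (rule that[of "(e, u, v)"]) (use e assms in \<open>auto simp: arcs_def\<close>)
qed

lemma adj_sym: "(u, v) \<in> adj G F \<Longrightarrow> (v, u) \<in> adj G F"
  by (auto simp: adj_def insert_commute)

lemma adj_rtrancl_sym: "(u, v) \<in> (adj G F)\<^sup>* \<Longrightarrow> (v, u) \<in> (adj G F)\<^sup>*"
  by (metis adj_sym sym_def symD sym_rtrancl)

lemma adj_mono: "F \<subseteq> F' \<Longrightarrow> adj G F \<subseteq> adj G F'"
  by (auto simp: adj_def)

lemma connected_by_boundary:
  assumes "connected_by G U F" "F \<subseteq> edges G" "W \<inter> U \<noteq> {}" "\<not> U \<subseteq> W"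
  shows "\<exists>a\<in>arcs G. arc_edge a \<in> F \<and> arc_tail a \<in> W \<and> arc_head a \<notin> W"
proof (rule ccontr)
  assume no: "\<not> ?thesis"
  obtain u v where uv: "u \<in> W" "u \<in> U" "v \<notin> W" "v \<in> U" using assms by auto
  have "(u, v) \<in> (adj G F)\<^sup>*" using assms(1) uv by (auto simp: connected_by_def)
  then have "v \<in> W"
  proof induction
    case (step y z)
    then show ?case using no by (metis adjE assms(2))
  qed (fact uv)
  with uv show False by simp
qed

lemma connected_byI_boundary:
  assumes "U \<noteq> {}"
    and "\<And>W. W \<subseteq> U \<Longrightarrow> W \<noteq> {} \<Longrightarrow> W \<noteq> U \<Longrightarrow>
      \<exists>a\<in>arcs G. arc_edge a \<in> F \<and> arc_tail a \<in> W \<and> arc_head a \<in> U - W"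
  shows "connected_by G U F"
  unfolding connected_by_def
proof (intro conjI ballI)
  fix u v assume "u \<in> U" "v \<in> U"
  show "(u, v) \<in> (adj G F)\<^sup>*"
  proof (rule ccontr)
    assume n: "(u, v) \<notin> (adj G F)\<^sup>*"
    define W where "W = {x \<in> U. (u, x) \<in> (adj G F)\<^sup>*}"
    obtain a where "a \<in> arcs G" "arc_edge a \<in> F" "arc_tail a \<in> W" "arc_head a \<in> U - W"
      using assms(2)[of W] n \<open>u \<in> U\<close> \<open>v \<in> U\<close> unfolding W_def by fastforce
    then show False
      unfolding W_def using adjI[of a G F] by (auto intro: rtrancl_into_rtrancl)
  qed
qed (use assms in auto)

text \<open>An induction principle: a maximal set that contains q and satisfies P has no boundary
  arc, since the step would enlarge it. It serves edge counting, the construction of firing scripts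
  and bounds on them.\<close>

lemma connected_by_grow:
  fixes G :: "('v::finite, 'e) multigraph"
  assumes "connected_by G UNIV F" "F \<subseteq> edges G" "P {q}"
    and step: "\<And>B a. q \<in> B \<Longrightarrow> P B \<Longrightarrow> a \<in> arcs G \<Longrightarrow> arc_edge a \<in> F \<Longrightarrow>
      arc_tail a \<in> B \<Longrightarrow> arc_head a \<notin> B \<Longrightarrow> P (insert (arc_head a) B)"
  shows "P UNIV"
proof -
  define S where "S = {B. q \<in> B \<and> P B}"
  have S: "finite S" "S \<noteq> {}" unfolding S_def using assms(3) by auto
  obtain B where B: "B \<in> S" "\<And>B'. B' \<in> S \<Longrightarrow> \<not> B \<subset> B'"
    using finite_has_maximal[OF S] by (metis less_le)
  show ?thesis
  proof (cases "B = UNIV")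
    case False
    then obtain a where a: "a \<in> arcs G" "arc_edge a \<in> F" "arc_tail a \<in> B" "arc_head a \<notin> B"
      using connected_by_boundary[OF assms(1,2), of B] B(1) unfolding S_def by blast
    then have "insert (arc_head a) B \<in> S" using B(1) step unfolding S_def by blast
    with B(2) a(4) show ?thesis by blast
  qed (use B in \<open>auto simp: S_def\<close>)
qed

text \<open>Each vertex added while growing is reached by an edge with an end outside the old set,
  hence by an edge not counted before.\<close>

lemma card_connected_by:
  fixes G :: "('v::finite, 'e::finite) multigraph"
  assumes "connected_by G UNIV F" "F \<subseteq> edges G"
  shows "CARD('v) \<le> card F + 1"
proof -
  define q :: 'v where "q = undefined"
  have "\<exists>F'\<subseteq>F. card (UNIV :: 'v set) = card F' + 1 \<and> (\<forall>e\<in>F'. ends G e \<subseteq> UNIV)"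
  proof (rule connected_by_grow[OF assms, of "\<lambda>B. \<exists>F'\<subseteq>F. card B = card F' + 1 \<and> (\<forall>e\<in>F'. ends G e \<subseteq> B)" q])
    fix B a assume "\<exists>F'\<subseteq>F. card B = card F' + 1 \<and> (\<forall>e\<in>F'. ends G e \<subseteq> B)"
      and a: "a \<in> arcs G" "arc_edge a \<in> F" "arc_tail a \<in> B" "arc_head a \<notin> B"
    then obtain F' where F': "F' \<subseteq> F" "card B = card F' + 1" "\<forall>e\<in>F'. ends G e \<subseteq> B" by blast
    have "ends G (arc_edge a) = {arc_tail a, arc_head a}" using a by (auto simp: arcs_def)
    moreover have "arc_edge a \<notin> F'" using calculation F' a by auto
    ultimately show "\<exists>F'\<subseteq>F. card (insert (arc_head a) B) = card F' + 1 \<and>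
        (\<forall>e\<in>F'. ends G e \<subseteq> insert (arc_head a) B)"
      using F' a by (intro exI[of _ "insert (arc_edge a) F'"]) auto
  qed auto
  then show ?thesis by (metis add_le_mono1 card_mono finite)
qed

lemma connected_by_tight_is_tree:
  fixes G :: "('v::finite, 'e::finite) multigraph"
  assumes "connected_by G UNIV T" "T \<subseteq> edges G" "card T + 1 \<le> CARD('v)"
  shows "T \<in> spanning_trees G"
proof -
  have "forest G T"
    unfolding forest_def
  proof clarify
    fix vs es assume c: "is_cycle G vs es" and sub: "set es \<subseteq> T"
    define n where "n = length es"
    have n: "n > 0" "length vs = n" and d: "distinct es"
      and ends: "\<And>i. i < n \<Longrightarrow> ends G (es ! i) = {vs ! i, vs ! (Suc i mod n)}"
      using c unfolding is_cycle_def n_def by auto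
    define F where "F = T - {es ! 0}"
    \<comment> \<open>Walk around the cycle from the far end of \<open>es ! 0\<close> without using
      that edge; at \<open>k = n - 1\<close> the walk arrives at \<open>vs ! 0\<close>. Indices
      modulo n also cover a cycle of length 1.\<close>
    have path: "(vs ! (1 mod n), vs ! (Suc k mod n)) \<in> (adj G F)\<^sup>*" if "k < n" for k
      using that
    proof (induction k)
      case (Suc k)
      have "es ! Suc k \<in> F" using Suc d sub unfolding F_def n_def
        by (metis DiffI Suc_lessD nat.distinct(1) nth_eq_iff_index_eq nth_mem singletonD subsetD length_pos_if_in_set)
      then have "(vs ! (Suc k mod n), vs ! (Suc (Suc k) mod n)) \<in> adj G F"
        using ends[of "Suc k"] Suc.prems unfolding adj_def by auto
      then show ?case using Suc by (auto intro: rtrancl_into_rtrancl)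
    qed auto
    have vv: "(vs ! (1 mod n), vs ! 0) \<in> (adj G F)\<^sup>*" using path[of "n - 1"] n by simp
    have e0: "ends G (es ! 0) = {vs ! 0, vs ! (1 mod n)}" using ends[of 0] n by simp
    have "(adj G T) \<subseteq> (adj G F)\<^sup>*"
    proof (rule subrelI)
      fix u v assume "(u, v) \<in> adj G T"
      then obtain e where e: "e \<in> T" "ends G e = {u, v}" by (auto simp: adj_def)
      show "(u, v) \<in> (adj G F)\<^sup>*"
      proof (cases "e = es ! 0")
        case True
        then have "u = vs ! 0 \<and> v = vs ! (1 mod n) \<or> u = vs ! (1 mod n) \<and> v = vs ! 0"
          using e e0 by (metis doubleton_eq_iff)
        then show ?thesis using vv adj_rtrancl_sym by metis
      qed (use e in \<open>auto simp: adj_def F_def\<close>)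
    qed
    then have "(adj G T)\<^sup>* \<subseteq> (adj G F)\<^sup>*" by (simp add: rtrancl_subset_rtrancl)
    then have "connected_by G UNIV F" using assms(1) unfolding connected_by_def by blast
    moreover have "F \<subseteq> edges G" using assms(2) F_def by auto
    ultimately have "CARD('v) \<le> card F + 1" by (rule card_connected_by)
    moreover have "es ! 0 \<in> T" using sub n n_def by auto
    ultimately show False using assms(3) card_Suc_Diff1[of T "es ! 0"] unfolding F_def by simp
  qed
  then show ?thesis using assms by (auto simp: spanning_trees_def)
qed

section \<open>Cuts and cocycles\<close>

locale conn_graph =
  fixes G :: "('v::finite, 'e::finite) multigraph"
  assumes loopless: "loopless G" and connected: "connected_graph G"
begin

lemma arc_tail_neq_head: "a \<in> arcs G \<Longrightarrow> arc_tail a \<noteq> arc_head a"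
  using loopless unfolding loopless_def arcs_def by fastforce

lemma ex_arc: "e \<in> edges G \<Longrightarrow> \<exists>a\<in>arcs G. arc_edge a = e"
proof -
  assume e: "e \<in> edges G"
  then obtain u v where "ends G e = {u, v}"
    using loopless unfolding loopless_def card_2_iff by blast
  with e show ?thesis by (intro bexI[of _ "(e, u, v)"]) (auto simp: arcs_def)
qed

lemma arc_same_edge: "a \<in> arcs G \<Longrightarrow> b \<in> arcs G \<Longrightarrow> arc_edge a = arc_edge b \<Longrightarrow> b = a \<or> b = arc_rev a"
  by (auto simp: arcs_def doubleton_eq_iff intro: arc_eqI)

lemma arc_rev_neq: "a \<in> arcs G \<Longrightarrow> arc_rev a \<noteq> a"
  using arc_tail_neq_head by (metis arc_rev_simps(2))

lemma cut_in_nonempty: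
  assumes "W \<noteq> {}" "W \<noteq> UNIV"
  shows "cut_in G W \<noteq> {}"
  using connected_by_boundary[of G UNIV "edges G" "- W"] connected assms
  unfolding connected_graph_def cut_in_def by blast

lemma arc_rev_cut_in: "arc_rev ` cut_in G W = cut_in G (- W)"
  by (auto simp: cut_in_def)

lemma arc_edge_cut_in: "arc_edge ` cut_in G W = edge_cut G W"
proof (intro subset_antisym subsetI)
  fix e assume "e \<in> edge_cut G W"
  then obtain a where a: "a \<in> arcs G" "arc_edge a = e" "ends G e \<inter> W \<noteq> {}" "ends G e \<inter> - W \<noteq> {}"
    using ex_arc unfolding edge_cut_def by blast
  then have "a \<in> cut_in G W \<or> arc_rev a \<in> cut_in G W"
    unfolding cut_in_def arcs_def by auto
  then show "e \<in> arc_edge ` cut_in G W" using a by (metis arc_rev_simps(1) image_eqI)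
qed (auto simp: cut_in_def edge_cut_def arcs_def)

lemma edge_cut_Compl: "edge_cut G (- W) = edge_cut G W"
  by (auto simp: edge_cut_def)

lemma cocycle_side_Compl: "cocycle_side G (- W) \<longleftrightarrow> cocycle_side G W"
  unfolding cocycle_side_def edge_cut_Compl by auto

lemma signed_cocycles_eq: "signed_cocycles G = {cut_in G W | W. cocycle_side G W}"
proof -
  have "{a \<in> arcs G. arc_tail a \<in> W \<and> arc_head a \<in> - W} = cut_in G (- W)" for W
    by (auto simp: cut_in_def)
  then show ?thesis
    unfolding signed_cocycles_def using cocycle_side_Compl by (auto, metis double_complement)
qed

text \<open>A set U whose cut lies inside that of W cannot split a connected side of W, since a
  separating edge would lie inside that side. So U is W or its complement, and minimality of the cut
  follows.\<close>

lemma cocycle_sideI: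
  assumes "W \<noteq> {}" "W \<noteq> UNIV" "induced_connected G W" "induced_connected G (- W)"
  shows "cocycle_side G W"
proof -
  have split: "U \<inter> X = {} \<or> X \<subseteq> U"
    if X: "induced_connected G X" "edge_cut G X = edge_cut G W" and U: "edge_cut G U \<subseteq> edge_cut G W" for U X
  proof (rule ccontr)
    assume "\<not> ?thesis"
    then obtain a where a: "a \<in> arcs G" "arc_edge a \<in> {e \<in> edges G. ends G e \<subseteq> X}"
      "arc_tail a \<in> U" "arc_head a \<notin> U"
      using connected_by_boundary[of G X "{e \<in> edges G. ends G e \<subseteq> X}" U] X(1)
      unfolding induced_connected_def by blast
    then have "arc_edge a \<in> edge_cut G U" unfolding edge_cut_def arcs_def by auto
    then have "arc_edge a \<in> edge_cut G X" using X U by auto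
    with a(2) show False unfolding edge_cut_def by auto
  qed
  have "edge_cut G U = edge_cut G W"
    if U: "U \<noteq> {}" "- U \<noteq> {}" "edge_cut G U \<subseteq> edge_cut G W" for U
  proof -
    have "U = W \<or> U = - W"
      using split[of W U] split[of "- W" U] assms U edge_cut_Compl by auto
    then show ?thesis using edge_cut_Compl by auto
  qed
  with assms show ?thesis unfolding cocycle_side_def by auto
qed

lemma induced_connectedI:
  assumes "W \<noteq> {}"
    and "\<And>X. X \<subseteq> W \<Longrightarrow> X \<noteq> {} \<Longrightarrow> X \<noteq> W \<Longrightarrow>
      \<exists>a\<in>arcs G. arc_tail a \<in> X \<and> arc_head a \<in> W - X"
  shows "induced_connected G W"
  unfolding induced_connected_def
proof (rule connected_byI_boundary)
  fix X assume "X \<subseteq> W" "X \<noteq> {}" "X \<noteq> W"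
  then obtain a where "a \<in> arcs G" "arc_tail a \<in> X" "arc_head a \<in> W - X" using assms(2) by blast
  with \<open>X \<subseteq> W\<close> show "\<exists>a\<in>arcs G. arc_edge a \<in> {e \<in> edges G. ends G e \<subseteq> W} \<and> arc_tail a \<in> X \<and> arc_head a \<in> W - X"
    by (intro bexI[of _ a]) (auto simp: arcs_def)
qed fact

text \<open>Take a directed cut of least size inside the given one. If a side fell apart, the
  directed cuts of its two pieces would be nonempty and disjoint inside the minimal one, so each
  would be smaller.\<close>

lemma cocycle_in_cut:
  assumes "W \<noteq> {}" "W \<noteq> UNIV"
  obtains U where "cocycle_side G U" "cut_in G U \<subseteq> cut_in G W"
proof -
  define S where "S = {U. U \<noteq> {} \<and> U \<noteq> UNIV \<and> cut_in G U \<subseteq> cut_in G W}"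
  have "finite S" "W \<in> S" using assms unfolding S_def by auto
  define U where "U = arg_min_on (\<lambda>U. card (cut_in G U)) S"
  have US: "U \<in> S" using arg_min_if_finite(1)[OF \<open>finite S\<close>] \<open>W \<in> S\<close> unfolding U_def by blast
  have min: "\<not> cut_in G U' \<subset> cut_in G U" if "U' \<noteq> {}" "U' \<noteq> UNIV" for U'
  proof
    assume "cut_in G U' \<subset> cut_in G U"
    then have "U' \<in> S" "card (cut_in G U') < card (cut_in G U)"
      using US that unfolding S_def by (auto intro: psubset_card_mono)
    then show False using arg_min_if_finite(2)[OF \<open>finite S\<close>, of "\<lambda>U. card (cut_in G U)"] \<open>W \<in> S\<close>
      unfolding U_def by blast
  qed
  have "induced_connected G U"
  proof (rule induced_connectedI, goal_cases)
    case (2 X)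
    show ?case
    proof (rule ccontr)
      assume n: "\<not> ?case"
      then have n: "\<not> (arc_tail a \<in> X \<and> arc_head a \<in> U - X)" "\<not> (arc_head a \<in> X \<and> arc_tail a \<in> U - X)"
        if "a \<in> arcs G" for a using that by (blast, metis arc_rev_in_arcs arc_rev_simps(2,3))
      have sub: "cut_in G X \<subseteq> cut_in G U" "cut_in G (U - X) \<subseteq> cut_in G U - cut_in G X"
        using n 2(1) unfolding cut_in_def by blast+
      have "cut_in G (U - X) \<noteq> {}" by (rule cut_in_nonempty) (use 2 in auto)
      with sub have "cut_in G X \<subset> cut_in G U" by blast
      then show False using min[of X] 2 US unfolding S_def by blast
    qed
  qed (use US S_def in auto)
  moreover have "induced_connected G (- U)"
  proof (rule induced_connectedI, goal_cases)
    case (2 X)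
    show ?case
    proof (rule ccontr)
      assume n: "\<not> ?case"
      then have n: "\<not> (arc_tail a \<in> X \<and> arc_head a \<in> - U - X)" "\<not> (arc_head a \<in> X \<and> arc_tail a \<in> - U - X)"
        if "a \<in> arcs G" for a using that by (blast, metis arc_rev_in_arcs arc_rev_simps(2,3))
      \<comment> \<open>Here the pieces lie outside U, so complements are taken to keep the arcs
        pointing in the direction of \<open>cut_in G U\<close>.\<close>
      have sub: "cut_in G (- X) \<subseteq> cut_in G U" "cut_in G (- (- U - X)) \<subseteq> cut_in G U - cut_in G (- X)"
        using n 2(1) unfolding cut_in_def by blast+
      have "cut_in G (- (- U - X)) \<noteq> {}" by (rule cut_in_nonempty) (use 2 in auto)
      with sub have "cut_in G (- X) \<subset> cut_in G U" by blast
      then show False using min[of "- X"] 2 US unfolding S_def by blast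
    qed
  qed (use US S_def in auto)
  ultimately show ?thesis using that US cocycle_sideI unfolding S_def by blast
qed

text \<open>A directed cocycle inside the cut and its reversal would both be the value of \<sigma>
  on the same edge set.\<close>

lemma no_opposite_cuts:
  assumes tri: "triangulating G \<sigma>" and T: "T1 \<in> spanning_trees G" "T2 \<in> spanning_trees G"
    and W: "W \<noteq> {}" "W \<noteq> UNIV"
    and sub: "cut_in G W \<subseteq> internal_atlas_of G \<sigma> T1" "arc_rev ` cut_in G W \<subseteq> internal_atlas_of G \<sigma> T2"
  shows False
proof -
  obtain U where U: "cocycle_side G U" "cut_in G U \<subseteq> cut_in G W" using cocycle_in_cut[OF W] by blast
  have "cut_in G U \<in> signed_cocycles G" "cut_in G (- U) \<in> signed_cocycles G"
    using U cocycle_side_Compl unfolding signed_cocycles_eq by blast+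
  moreover have "cut_in G U \<subseteq> internal_atlas_of G \<sigma> T1" "cut_in G (- U) \<subseteq> internal_atlas_of G \<sigma> T2"
    using U sub unfolding arc_rev_cut_in[symmetric] by auto
  ultimately have "cut_in G U = \<sigma> (arc_edge ` cut_in G U)" "cut_in G (- U) = \<sigma> (arc_edge ` cut_in G (- U))"
    using tri T unfolding triangulating_def by blast+
  then have "cut_in G U = cut_in G (- U)" by (simp add: arc_edge_cut_in edge_cut_Compl)
  moreover have "cut_in G U \<noteq> {}" using U(1) unfolding cocycle_side_def by (intro cut_in_nonempty) auto
  ultimately show False unfolding cut_in_def by auto
qed

end

section \<open>Size of spanning trees and their fundamental cocycles\<close>

locale lawrence_graph = conn_graph G for G :: "('v::finite, 'e::finite) multigraph" +
  fixes ref :: "'e \<Rightarrow> ('v, 'e) arc" and R :: "'r::finite set" and M :: "real^'e^'r"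
  assumes ref: "reference_orientation G ref" and lawrence: "lawrence_matrix G ref R M"
begin

text \<open>The upper bound is linear algebra: the columns of \<open>M\<close> over a forest are
  independent and vanish outside the coordinates in \<open>R\<close>. The lower bound is the edge
  count for connected edge sets.\<close>

lemma card_spanning_tree:
  assumes "T \<in> spanning_trees G"
  shows "card T + 1 = CARD('v)"
proof (rule antisym)
  have T: "T \<subseteq> edges G" "connected_by G UNIV T" "forest G T" using assms by (auto simp: spanning_trees_def)
  then have ind: "inj_on (\<lambda>e. column e M) T" "independent ((\<lambda>e. column e M) ` T)"
    using lawrence unfolding lawrence_matrix_def represents_graphic_matroid_def by auto
  have sub: "(\<lambda>e. column e M) ` T \<subseteq> {x. \<forall>i. i \<notin> R \<longrightarrow> x $ i = 0}"
    using lawrence unfolding lawrence_matrix_def by (auto simp: column_def)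
  have "card T = card ((\<lambda>e. column e M) ` T)" using ind(1) by (simp add: card_image)
  also have "\<dots> \<le> dim {x :: real^'r. \<forall>i. i \<notin> R \<longrightarrow> x $ i = 0}"
    using independent_card_le_dim[OF sub ind(2)] .
  also have "\<dots> = card R" by (simp add: dim_vec_eq[symmetric] dim_substandard_cart)
  also have "\<dots> = CARD('v) - 1" using lawrence unfolding lawrence_matrix_def by auto
  finally show "card T + 1 \<le> CARD('v)" using zero_less_card_finite[where 'a='v] by linarith
  show "CARD('v) \<le> card T + 1" using card_connected_by T by blast
qed

lemma fundamental_cocycle_side:
  assumes "T \<in> spanning_trees G" "e \<in> T"
  obtains W where "cocycle_side G W" "fundamental_cocycle G T e = edge_cut G W" "e \<in> edge_cut G W"
proof -
  have T: "T \<subseteq> edges G" "connected_by G UNIV T" using assms by (auto simp: spanning_trees_def)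
  define F where "F = T - {e}"
  have F: "F \<subseteq> edges G" using T F_def by auto
  have "card F + 1 < CARD('v)"
    using card_spanning_tree[OF assms(1)] assms(2) card_Suc_Diff1[of T e] unfolding F_def by simp
  then have nc: "\<not> connected_by G UNIV F" using card_connected_by[OF _ F] by force
  obtain a where a: "a \<in> arcs G" "arc_edge a = e" using ex_arc assms T by blast
  define comp where "comp u = {x. (u, x) \<in> (adj G F)\<^sup>*}" for u
  have closed: "arc_head b \<in> comp u" if "arc_tail b \<in> comp u" "b \<in> arcs G" "arc_edge b \<in> F" for b u
    using that adjI[of b G F] unfolding comp_def by (auto intro: rtrancl_into_rtrancl)
  have un: "comp (arc_tail a) \<union> comp (arc_head a) = UNIV"
  proof (rule ccontr)
    assume "\<not> ?thesis"
    moreover have "arc_tail a \<in> comp (arc_tail a)" unfolding comp_def by simp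
    ultimately obtain b where b: "b \<in> arcs G" "arc_edge b \<in> T"
       "arc_tail b \<in> comp (arc_tail a) \<union> comp (arc_head a)" "arc_head b \<notin> comp (arc_tail a) \<union> comp (arc_head a)"
      using connected_by_boundary[OF T(2,1), of "comp (arc_tail a) \<union> comp (arc_head a)"] by blast
    then have "arc_edge b \<notin> F" using closed by blast
    then have "arc_edge a = arc_edge b" using a b F_def by auto
    then have "b = a \<or> b = arc_rev a" using arc_same_edge a b by blast
    then show False using b unfolding comp_def by auto
  qed
  \<comment> \<open>If the ends of e were still joined without e, the remaining edges would connect
    all vertices, but there are too few of them.\<close>
  have nin: "arc_head a \<notin> comp (arc_tail a)"
  proof
    assume h: "arc_head a \<in> comp (arc_tail a)"
    then have "comp (arc_head a) \<subseteq> comp (arc_tail a)" unfolding comp_def by auto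
    then have "comp (arc_tail a) = UNIV" using un by auto
    then have "(x, y) \<in> (adj G F)\<^sup>*" for x y
      using adj_rtrancl_sym unfolding comp_def by (metis UNIV_I mem_Collect_eq rtrancl_trans)
    then show False using nc unfolding connected_by_def by auto
  qed
  define W where "W = comp (arc_tail a)"
  have W': "- W = comp (arc_head a)"
  proof -
    have "x \<notin> comp (arc_tail a)" if "x \<in> comp (arc_head a)" for x
      using that nin adj_rtrancl_sym unfolding comp_def by (metis mem_Collect_eq rtrancl_trans)
    then show ?thesis using un unfolding W_def by blast
  qed
  have ind: "induced_connected G (comp u)" for u
  proof (rule induced_connectedI)
    fix X assume X: "X \<subseteq> comp u" "X \<noteq> {}" "X \<noteq> comp u"
    have "connected_by G (comp u) F"
      unfolding connected_by_def comp_def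
      by (metis adj_rtrancl_sym empty_iff mem_Collect_eq rtrancl.rtrancl_refl rtrancl_trans)
    then obtain b where "b \<in> arcs G" "arc_edge b \<in> F" "arc_tail b \<in> X" "arc_head b \<notin> X"
      using connected_by_boundary[of G "comp u" F X] F X by blast
    then show "\<exists>a\<in>arcs G. arc_tail a \<in> X \<and> arc_head a \<in> comp u - X"
      using closed X by blast
  qed (auto simp: comp_def)
  have "cocycle_side G W"
    using nin ind W' unfolding W_def by (intro cocycle_sideI) (auto simp: comp_def)
  moreover have "fundamental_cocycle G T e = edge_cut G W"
  proof -
    have mem: "(x, y) \<in> (adj G F)\<^sup>* \<longleftrightarrow> (x \<in> W \<longleftrightarrow> y \<in> W)" for x y
    proof
      show "(x \<in> W \<longleftrightarrow> y \<in> W)" if "(x, y) \<in> (adj G F)\<^sup>*"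
        using that adj_rtrancl_sym unfolding W_def comp_def by (metis mem_Collect_eq rtrancl_trans)
      assume iff: "(x \<in> W \<longleftrightarrow> y \<in> W)"
      obtain u where "x \<in> comp u" "y \<in> comp u"
        using iff un W' unfolding W_def by blast
      then show "(x, y) \<in> (adj G F)\<^sup>*"
        using adj_rtrancl_sym unfolding comp_def by (metis mem_Collect_eq rtrancl_trans)
    qed
    have "(\<exists>u v. ends G f = {u, v} \<and> (u, v) \<notin> (adj G F)\<^sup>*) \<longleftrightarrow>
        ends G f \<inter> W \<noteq> {} \<and> ends G f \<inter> - W \<noteq> {}" if "f \<in> edges G" for f
    proof -
      obtain x y where xy: "ends G f = {x, y}"
        using loopless \<open>f \<in> edges G\<close> unfolding loopless_def card_2_iff by blast
      show ?thesis unfolding mem xy by (auto simp: doubleton_eq_iff)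
    qed
    then show ?thesis unfolding fundamental_cocycle_def edge_cut_def F_def by blast
  qed
  moreover have "e \<in> edge_cut G W"
  proof -
    have "arc_tail a \<in> W" "arc_head a \<notin> W" using nin unfolding W_def by (auto simp: comp_def)
    then show ?thesis using a unfolding edge_cut_def arcs_def by auto
  qed
  ultimately show ?thesis using that by blast
qed

text \<open>A signed cocycle carries exactly one of the two arcs of each of its edges, and e lies in
  its own fundamental cocycle.\<close>

lemma one_way_internal_atlas:
  assumes "cocycle_signature G \<sigma>" "T \<in> spanning_trees G" "e \<in> T"
  shows "one_way (internal_atlas_of G \<sigma> T) e"
proof -
  define C where "C = fundamental_cocycle G T e"
  have C: "C \<in> cocycles G" "e \<in> C"
    using fundamental_cocycle_side[OF assms(2,3)] unfolding C_def cocycles_def by blast+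
  have \<sigma>C: "\<sigma> C \<in> signed_cocycles G" "arc_edge ` \<sigma> C = C"
    using assms(1) C(1) unfolding cocycle_signature_def by auto
  then obtain U where U: "\<sigma> C = cut_in G U" unfolding signed_cocycles_eq by auto
  obtain a where a: "a \<in> \<sigma> C" "arc_edge a = e" using C(2) \<sigma>C(2) by (metis imageE)
  have iff: "b \<in> internal_atlas_of G \<sigma> T \<longleftrightarrow> b \<in> cut_in G U" if "arc_edge b = e" for b
    using that U assms(3) unfolding internal_atlas_of_def C_def cut_in_def by auto
  show ?thesis unfolding one_way_def
  proof (rule ex1I[of _ a])
    show "a \<in> internal_atlas_of G \<sigma> T \<and> arc_edge a = e" using a iff[of a] U by blast
    fix b assume b: "b \<in> internal_atlas_of G \<sigma> T \<and> arc_edge b = e"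
    then have "b \<in> cut_in G U" using iff by blast
    then show "b = a" using a U arc_same_edge[of a b] b unfolding cut_in_def by fastforce
  qed
qed

end

section \<open>Linear equivalence and the Laplacian\<close>

text \<open>The sign is that of the chip gain when every vertex x fires \<open>f x\<close> times, so
  this is minus the usual Laplacian. Summing over arcs accounts for parallel edges.\<close>

definition lap :: "('v, 'e) multigraph \<Rightarrow> ('v \<Rightarrow> int) \<Rightarrow> 'v divisor" where
  "lap G f = (\<lambda>w. \<Sum>a | a \<in> arcs G \<and> arc_head a = w. f (arc_tail a) - f w)"

lemma lap_add: "lap G (\<lambda>x. f x + g x) w = lap G f w + lap G g w"
  unfolding lap_def sum.distrib[symmetric] by (rule sum.cong) auto

lemma lap_mult: "lap G (\<lambda>x. c * f x) w = c * lap G f w"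
  unfolding lap_def sum_distrib_left by (rule sum.cong) (auto simp: algebra_simps)

lemma lap_minus: "lap G (\<lambda>x. - f x) w = - lap G f w"
  using lap_mult[of G "-1" f w] by simp

lemma lap_const: "lap G (\<lambda>x. c) w = 0"
  by (simp add: lap_def)

lemma card_arcs_rev: "card {a \<in> arcs G. P (arc_tail a) (arc_head a)} = card {a \<in> arcs G. P (arc_head a) (arc_tail a)}"
proof -
  have "arc_rev ` {a \<in> arcs G. P (arc_tail a) (arc_head a)} = {a \<in> arcs G. P (arc_head a) (arc_tail a)}"
    by (intro subset_antisym subsetI) simp_all
  then show ?thesis using card_image[OF inj_arc_rev, of "{a \<in> arcs G. P (arc_tail a) (arc_head a)}"] by simp
qed

lemma fire_eq_lap:
  fixes G :: "('v::finite, 'e::finite) multigraph"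
  shows "fire G v D = (\<lambda>w. D w + lap G (chip v) w)"
proof
  fix w
  have "lap G (chip v) w = (\<Sum>a\<in>{a \<in> arcs G. arc_head a = w}. if arc_tail a = v then 1 else 0)
       - (\<Sum>a\<in>{a \<in> arcs G. arc_head a = w}. if w = v then 1 else 0)"
    unfolding lap_def chip_def sum_subtractf by simp
  also have "(\<Sum>a\<in>{a \<in> arcs G. arc_head a = w}. if arc_tail a = v then 1 else 0)
      = int (card ({a \<in> arcs G. arc_head a = w} \<inter> {a. arc_tail a = v}))"
    by (simp add: sum.If_cases)
  also have "{a \<in> arcs G. arc_head a = w} \<inter> {a. arc_tail a = v} = {a \<in> arcs G. arc_tail a = v \<and> arc_head a = w}"
    by auto
  also have "(\<Sum>a\<in>{a \<in> arcs G. arc_head a = w}. if w = v then 1 else (0::int))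
     = (if w = v then int (card {a \<in> arcs G. arc_tail a = v}) else 0)"
    using card_arcs_rev[of G "\<lambda>t h. h = v"] by simp
  finally show "fire G v D w = D w + lap G (chip v) w"
    unfolding fire_def by simp
qed

lemma linearly_equivalent_trans:
  "linearly_equivalent G D D' \<Longrightarrow> linearly_equivalent G D' D'' \<Longrightarrow> linearly_equivalent G D D''"
  unfolding linearly_equivalent_def by (rule rtranclp_trans)

lemma linearly_equivalent_fire:
  "E = fire G v D \<or> D = fire G v E \<Longrightarrow> linearly_equivalent G D E"
  unfolding linearly_equivalent_def by blast

lemma linearly_equivalent_add_lap:
  fixes G :: "('v::finite, 'e::finite) multigraph"
  shows "linearly_equivalent G D (\<lambda>w. D w + lap G f w)"
proof -
  have step: "linearly_equivalent G D (\<lambda>w. D w + lap G (\<lambda>y. k * chip x y) w)" for D k x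
  proof (induction k rule: int_induct[where k = 0])
    case base
    then show ?case by (simp add: lap_const linearly_equivalent_def)
  next
    case (step1 i)
    have "lap G (\<lambda>y. (i + 1) * chip x y) w = lap G (\<lambda>y. i * chip x y) w + lap G (chip x) w" for w
      unfolding lap_mult by (simp add: distrib_right)
    then have "(\<lambda>w. D w + lap G (\<lambda>y. (i + 1) * chip x y) w) = fire G x (\<lambda>w. D w + lap G (\<lambda>y. i * chip x y) w)"
      by (simp add: fire_eq_lap add.assoc)
    then show ?case by (intro linearly_equivalent_trans[OF step1(2) linearly_equivalent_fire] disjI1)
  next
    case (step2 i)
    have "lap G (\<lambda>y. i * chip x y) w = lap G (\<lambda>y. (i - 1) * chip x y) w + lap G (chip x) w" for w
      unfolding lap_mult by (simp add: left_diff_distrib)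
    then have "(\<lambda>w. D w + lap G (\<lambda>y. i * chip x y) w) = fire G x (\<lambda>w. D w + lap G (\<lambda>y. (i - 1) * chip x y) w)"
      by (simp add: fire_eq_lap add.assoc)
    then show ?case by (intro linearly_equivalent_trans[OF step2(2) linearly_equivalent_fire] disjI2)
  qed
  \<comment> \<open>Induction on the support of the script: each vertex of the support performs its
    \<open>f x\<close> firings in one block.\<close>
  have "\<forall>f. (\<forall>x. x \<notin> S \<longrightarrow> f x = 0) \<longrightarrow> (\<forall>D. linearly_equivalent G D (\<lambda>w. D w + lap G f w))" if "finite S" for S
    using that
  proof (induction S)
    case empty
    show ?case
    proof (intro allI impI)
      fix f :: "'v \<Rightarrow> int" and D assume "\<forall>x. x \<notin> {} \<longrightarrow> f x = 0"
      then have "f = (\<lambda>_. 0)" by auto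
      then show "linearly_equivalent G D (\<lambda>w. D w + lap G f w)"
        by (simp add: lap_const linearly_equivalent_def)
    qed
  next
    case (insert x S)
    show ?case
    proof (intro allI impI)
      fix f :: "'v \<Rightarrow> int" and D assume f: "\<forall>y. y \<notin> insert x S \<longrightarrow> f y = 0"
      define g where "g = f(x := 0)"
      have "f = (\<lambda>y. g y + f x * chip x y)" unfolding g_def chip_def by auto
      then have "lap G f w = lap G g w + lap G (\<lambda>y. f x * chip x y) w" for w
        using lap_add[of G g "\<lambda>y. f x * chip x y" w] by metis
      then have "(\<lambda>w. D w + lap G f w) = (\<lambda>w. (D w + lap G g w) + lap G (\<lambda>y. f x * chip x y) w)"
        by (simp add: add.assoc)
      moreover have "linearly_equivalent G D (\<lambda>w. D w + lap G g w)"
        using insert f unfolding g_def by auto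
      ultimately show "linearly_equivalent G D (\<lambda>w. D w + lap G f w)"
        using step[of "\<lambda>w. D w + lap G g w" "f x" x] linearly_equivalent_trans by metis
    qed
  qed
  from this[of UNIV] show ?thesis by simp
qed

lemma linearly_equivalent_iff_lap:
  fixes G :: "('v::finite, 'e::finite) multigraph"
  shows "linearly_equivalent G D D' \<longleftrightarrow> (\<exists>f. D' = (\<lambda>w. D w + lap G f w))"
proof
  assume "linearly_equivalent G D D'"
  then show "\<exists>f. D' = (\<lambda>w. D w + lap G f w)"
    unfolding linearly_equivalent_def
  proof induction
    case base
    show ?case by (intro exI[of _ "\<lambda>_. 0"]) (simp add: lap_const)
  next
    case (step E E')
    then obtain f v where f: "E = (\<lambda>w. D w + lap G f w)" "E' = fire G v E \<or> E = fire G v E'" by blast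
    from f(2) show ?case
    proof
      assume "E' = fire G v E"
      then show ?thesis
        by (intro exI[of _ "\<lambda>x. f x + chip v x"]) (simp add: f fire_eq_lap lap_add add.assoc)
    next
      assume E: "E = fire G v E'"
      have "E' w = E w - lap G (chip v) w" for w unfolding E fire_eq_lap by simp
      then have "E' = (\<lambda>w. D w + lap G (\<lambda>x. f x + - chip v x) w)"
        unfolding lap_add lap_minus by (auto simp: f(1))
      then show ?thesis by blast
    qed
  qed
qed (use linearly_equivalent_add_lap in blast)

lemma linearly_equivalent_sym:
  fixes G :: "('v::finite, 'e::finite) multigraph"
  assumes "linearly_equivalent G D D'" shows "linearly_equivalent G D' D"
proof -
  from assms obtain f where "D' = (\<lambda>w. D w + lap G f w)" unfolding linearly_equivalent_iff_lap by blast
  then have "D = (\<lambda>w. D' w + lap G (\<lambda>x. - f x) w)" by (simp add: lap_minus)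
  then show ?thesis unfolding linearly_equivalent_iff_lap by blast
qed

lemma sum_heads:
  fixes S :: "('v::finite, 'e::finite) arc set"
  shows "(\<Sum>w\<in>W. \<Sum>a | a \<in> S \<and> arc_head a = w. h a) = (\<Sum>a | a \<in> S \<and> arc_head a \<in> W. h a)"
proof -
  have "(\<Sum>w\<in>W. sum h {a \<in> {a \<in> S. arc_head a \<in> W}. arc_head a = w}) = sum h {a \<in> S. arc_head a \<in> W}"
    by (rule sum.group) auto
  moreover have "{a \<in> {a \<in> S. arc_head a \<in> W}. arc_head a = w} = {a \<in> S. arc_head a = w}" if "w \<in> W" for w
    using that by auto
  ultimately show ?thesis by simp
qed

text \<open>Arcs inside W cancel against their reversals, so the chips gained by W all pass through
  its cut.\<close>

lemma sum_lap:
  fixes G :: "('v::finite, 'e::finite) multigraph"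
  shows "(\<Sum>w\<in>W. lap G f w) = (\<Sum>a\<in>cut_in G W. f (arc_tail a) - f (arc_head a))"
proof -
  let ?h = "\<lambda>a. f (arc_tail a) - f (arc_head a)"
  define I where "I = {a \<in> arcs G. arc_tail a \<in> W \<and> arc_head a \<in> W}"
  have "(\<Sum>w\<in>W. lap G f w) = (\<Sum>a | a \<in> arcs G \<and> arc_head a \<in> W. ?h a)"
    unfolding lap_def sum_heads[symmetric] by (intro sum.cong) auto
  also have "{a. a \<in> arcs G \<and> arc_head a \<in> W} = cut_in G W \<union> I"
    unfolding cut_in_def I_def by auto
  also have "sum ?h (cut_in G W \<union> I) = sum ?h (cut_in G W) + sum ?h I"
    by (rule sum.union_disjoint) (auto simp: cut_in_def I_def)
  also have "sum ?h I = 0"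
  proof -
    have "arc_rev ` I = I" by (intro subset_antisym subsetI) (simp_all add: I_def)
    then have "sum ?h I = sum (?h \<circ> arc_rev) I" using sum.reindex[OF inj_arc_rev[of I], of ?h] by simp
    also have "\<dots> = - sum ?h I" unfolding sum_negf[symmetric] by (intro sum.cong) auto
    finally show ?thesis by simp
  qed
  finally show ?thesis by simp
qed

lemma degree_div_add_lap:
  fixes G :: "('v::finite, 'e::finite) multigraph"
  shows "degree_div (\<lambda>w. D w + lap G f w) = degree_div D"
  using sum_lap[of G f UNIV] unfolding degree_div_def sum.distrib by (simp add: cut_in_def)

section \<open>Orientations\<close>

context conn_graph
begin

lemma one_way_rev_iff:
  assumes "one_way F (arc_edge a)" "F \<subseteq> arcs G" "a \<in> arcs G"
  shows "arc_rev a \<in> F \<longleftrightarrow> a \<notin> F"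
proof -
  obtain b where b: "b \<in> F" "arc_edge b = arc_edge a" "\<And>c. c \<in> F \<Longrightarrow> arc_edge c = arc_edge a \<Longrightarrow> c = b"
    using assms(1) unfolding one_way_def by blast
  have "b = a \<or> b = arc_rev a" using arc_same_edge[of a b] assms(2,3) b(1,2) by auto
  then show ?thesis
  proof
    assume "b = a"
    then show ?thesis using b(1) b(3)[of "arc_rev a"] arc_rev_neq[OF assms(3)] by auto
  next
    assume "b = arc_rev a"
    then show ?thesis using b(1) b(3)[of a] arc_rev_neq[OF assms(3)] by auto
  qed
qed

lemma one_wayI:
  assumes "F \<subseteq> arcs G" "e \<in> edges G" "\<And>a. a \<in> arcs G \<Longrightarrow> arc_edge a = e \<Longrightarrow> arc_rev a \<in> F \<longleftrightarrow> a \<notin> F"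
  shows "one_way F e"
proof -
  obtain a where a: "a \<in> arcs G" "arc_edge a = e" using ex_arc assms(2) by blast
  define b where "b = (if a \<in> F then a else arc_rev a)"
  have b: "b \<in> F" "arc_edge b = e" "b \<in> arcs G" using assms(3) a unfolding b_def by auto
  have "c = b" if "c \<in> F" "arc_edge c = e" for c
  proof -
    have "c = b \<or> c = arc_rev b" using arc_same_edge[of b c] b that assms(1) by auto
    then show ?thesis using assms(3)[OF b(3,2)] b(1) that(1) by blast
  qed
  with b show ?thesis unfolding one_way_def by blast
qed

lemma orientation_ofD:
  assumes "orientation_of G S F"
  shows "F \<subseteq> arcs G" "a \<in> F \<Longrightarrow> arc_edge a \<in> S" "inj_on arc_edge F" "arc_edge ` F = S"
    "a \<in> arcs G \<Longrightarrow> arc_edge a \<in> S \<Longrightarrow> arc_rev a \<in> F \<longleftrightarrow> a \<notin> F"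
proof -
  show sub: "F \<subseteq> arcs G" and "a \<in> F \<Longrightarrow> arc_edge a \<in> S" using assms unfolding orientation_of_def by auto
  have ex1: "\<exists>!a. a \<in> F \<and> arc_edge a = e" if "e \<in> S" for e
    using assms that unfolding orientation_of_def one_way_def by auto
  have e: "arc_edge a \<in> S" if "a \<in> F" for a using assms that unfolding orientation_of_def by auto
  show "inj_on arc_edge F" using ex1 e by (intro inj_onI) metis
  show "arc_edge ` F = S" using ex1 e by blast
  show "a \<in> arcs G \<Longrightarrow> arc_edge a \<in> S \<Longrightarrow> arc_rev a \<in> F \<longleftrightarrow> a \<notin> F"
    using one_way_rev_iff[OF _ sub, of a] assms unfolding orientation_of_def by blast
qed

lemma card_orientation_of: "orientation_of G S F \<Longrightarrow> card F = card S"
  using card_image[OF orientation_ofD(3)] orientation_ofD(4) by fastforce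

lemma break_div_disjoint_Un:
  fixes A B :: "('v, 'e) arc set"
  shows "A \<inter> B = {} \<Longrightarrow> break_div (A \<union> B) v = break_div A v + break_div B v"
proof -
  assume "A \<inter> B = {}"
  then have "card ({a \<in> A. arc_head a = v} \<union> {a \<in> B. arc_head a = v}) =
      card {a \<in> A. arc_head a = v} + card {a \<in> B. arc_head a = v}"
    by (intro card_Un_disjoint) auto
  moreover have "{a \<in> A \<union> B. arc_head a = v} = {a \<in> A. arc_head a = v} \<union> {a \<in> B. arc_head a = v}" by auto
  ultimately show ?thesis unfolding break_div_def by simp
qed

lemma sum_break_div:
  fixes F :: "('v, 'e) arc set"
  shows "(\<Sum>w\<in>W. break_div F w) = int (card {a \<in> F. arc_head a \<in> W})"
proof -
  have "(\<Sum>w\<in>W. int (card {a \<in> F. arc_head a = w})) = (\<Sum>w\<in>W. \<Sum>a | a \<in> F \<and> arc_head a = w. 1)"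
    by (intro sum.cong) auto
  then show ?thesis unfolding break_div_def sum_heads by simp
qed

lemma degree_break_div: "orientation_of G S F \<Longrightarrow> degree_div (break_div F) = int (card S)"
  unfolding degree_div_def sum_break_div by (simp add: card_orientation_of)

text \<open>An edge inside W has its head in W whichever way it is oriented; only the cut depends on
  the orientation. This makes orientations comparable on W.\<close>

lemma sum_break_div_orientation:
  assumes O: "orientation_of G (edges G) F"
  shows "(\<Sum>w\<in>W. break_div F w) = int (card {e \<in> edges G. ends G e \<subseteq> W}) + int (card (F \<inter> cut_in G W))"
proof -
  let ?I = "{a \<in> F. arc_tail a \<in> W \<and> arc_head a \<in> W}"
  have sub: "F \<subseteq> arcs G" using orientation_ofD(1)[OF O] .
  have "arc_edge ` ?I = {e \<in> edges G. ends G e \<subseteq> W}"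
  proof (intro subset_antisym subsetI)
    fix e assume e: "e \<in> {e \<in> edges G. ends G e \<subseteq> W}"
    have "e \<in> arc_edge ` F" using orientation_ofD(4)[OF O] e by auto
    then obtain a where a: "a \<in> F" "arc_edge a = e" by (metis imageE)
    then have "a \<in> ?I" using sub e unfolding arcs_def by auto
    then show "e \<in> arc_edge ` ?I" using a by blast
  qed (use sub in \<open>auto simp: arcs_def\<close>)
  moreover have "inj_on arc_edge ?I" using orientation_ofD(3)[OF O] by (rule inj_on_subset) auto
  ultimately have I: "card {e \<in> edges G. ends G e \<subseteq> W} = card ?I"
    using card_image[of arc_edge ?I] by simp
  have "{a \<in> F. arc_head a \<in> W} = ?I \<union> (F \<inter> cut_in G W)" using sub unfolding cut_in_def by blast
  then have "card {a \<in> F. arc_head a \<in> W} = card ?I + card (F \<inter> cut_in G W)"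
    by (simp add: card_Un_disjoint cut_in_def disjoint_iff)
  then show ?thesis unfolding sum_break_div I by simp
qed

text \<open>
  \<open>W\<close> is the set where the firing script is maximal.  Firing takes at least one chip out of \<open>W\<close> along
  each edge of the cut, whereas the two orientations differ by at most the size of the cut.
\<close>

lemma equivalent_orientations:
  assumes O1: "orientation_of G (edges G) F1" and O2: "orientation_of G (edges G) F2"
    and eq: "\<And>v. break_div F2 v = break_div F1 v + lap G f v" and nc: "f x \<noteq> f y"
  obtains W where "W \<noteq> {}" "W \<noteq> UNIV" "cut_in G W \<subseteq> F1" "arc_rev ` cut_in G W \<subseteq> F2"
proof -
  define m where "m = Max (range f)"
  have m: "f v \<le> m" for v unfolding m_def by auto
  have "m \<in> range f" unfolding m_def by (intro Max_in) auto
  define W where "W = {v. f v = m}"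
  have "W \<noteq> {}" using \<open>m \<in> range f\<close> unfolding W_def by auto
  moreover have "x \<notin> W \<or> y \<notin> W" using nc unfolding W_def by auto
  ultimately have W: "W \<noteq> {}" "W \<noteq> UNIV" by auto
  have drop: "f (arc_tail a) - f (arc_head a) \<le> -1" if "a \<in> cut_in G W" for a
    using that m[of "arc_tail a"] unfolding cut_in_def W_def by auto
  have "int (card (F2 \<inter> cut_in G W)) = int (card (F1 \<inter> cut_in G W)) + (\<Sum>w\<in>W. lap G f w)"
    using sum_break_div_orientation[OF O1, of W] sum_break_div_orientation[OF O2, of W] eq by (simp add: sum.distrib)
  also have "(\<Sum>w\<in>W. lap G f w) \<le> (\<Sum>a\<in>cut_in G W. -1)"
    unfolding sum_lap by (rule sum_mono) (use drop in auto)
  finally have le: "card (F2 \<inter> cut_in G W) + card (cut_in G W) \<le> card (F1 \<inter> cut_in G W)" by simp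
  moreover have "card (F1 \<inter> cut_in G W) \<le> card (cut_in G W)" by (rule card_mono) auto
  ultimately have c: "card (F2 \<inter> cut_in G W) = 0" "card (F1 \<inter> cut_in G W) = card (cut_in G W)" by linarith+
  have "F1 \<inter> cut_in G W = cut_in G W" by (rule card_subset_eq) (use c in auto)
  moreover have "F2 \<inter> cut_in G W = {}" using c(1) by simp
  then have "arc_rev ` cut_in G W \<subseteq> F2"
    using orientation_ofD(5)[OF O2] unfolding cut_in_def by (auto simp: arc_edge_in_edges disjoint_iff simp del: split_paired_All)
  ultimately show ?thesis using that W by blast
qed

end

section \<open>Generalized break divisors as indegrees of orientations inside internally oriented
  trees\<close>

context lawrence_graph
begin

definition tree_arcs :: "('e set \<Rightarrow> ('v, 'e) arc set) \<Rightarrow> 'e set \<Rightarrow> ('v, 'e) arc set" where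
  "tree_arcs \<sigma> T = {a \<in> internal_atlas_of G \<sigma> T. arc_edge a \<in> T}"

lemma internal_atlas_subset: "internal_atlas_of G \<sigma> T \<subseteq> arcs G"
  by (auto simp: internal_atlas_of_def)

lemma spanning_tree_subset: "T \<in> spanning_trees G \<Longrightarrow> T \<subseteq> edges G"
  by (auto simp: spanning_trees_def)

lemma internal_atlas_off_tree: "a \<in> arcs G \<Longrightarrow> arc_edge a \<notin> T \<Longrightarrow> a \<in> internal_atlas_of G \<sigma> T"
  by (auto simp: internal_atlas_of_def)

lemma orientation_tree_arcs:
  assumes "cocycle_signature G \<sigma>" "T \<in> spanning_trees G"
  shows "orientation_of G T (tree_arcs \<sigma> T)"
  unfolding orientation_of_def
proof (intro conjI ballI)
  fix e assume "e \<in> T"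
  then have "one_way (internal_atlas_of G \<sigma> T) e" using one_way_internal_atlas assms by blast
  then show "one_way (tree_arcs \<sigma> T) e" using \<open>e \<in> T\<close> unfolding one_way_def tree_arcs_def by auto
qed (use internal_atlas_subset in \<open>auto simp: tree_arcs_def\<close>)

text \<open>The complement turns off-tree edges from bioriented to unoriented and reverses the tree
  edges; the negation then reverses the tree edges back.\<close>

lemma I_sig_eq:
  assumes "cocycle_signature G \<sigma>" "T \<in> spanning_trees G"
  shows "I_sig G q \<sigma> T = (\<lambda>v. break_div (tree_arcs \<sigma> T) v - 1 + chip q v)"
proof -
  have F: "fourientation_neg (fourientation_compl G (internal_atlas_of G \<sigma> T)) = tree_arcs \<sigma> T"
  proof (intro subset_antisym subsetI)
    fix a assume "a \<in> fourientation_neg (fourientation_compl G (internal_atlas_of G \<sigma> T))"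
    then have a: "arc_rev a \<in> arcs G" "arc_rev a \<notin> internal_atlas_of G \<sigma> T"
      by (auto simp: fourientation_neg_def fourientation_compl_def)
    then have "arc_edge a \<in> T" using internal_atlas_off_tree by (metis arc_rev_simps(1))
    then show "a \<in> tree_arcs \<sigma> T"
      using orientation_ofD(5)[OF orientation_tree_arcs[OF assms], of a] a unfolding tree_arcs_def by auto
  next
    fix a assume a: "a \<in> tree_arcs \<sigma> T"
    then have "a \<in> arcs G" "arc_edge a \<in> T" using internal_atlas_subset by (auto simp: tree_arcs_def)
    then have "arc_rev a \<notin> internal_atlas_of G \<sigma> T"
      using orientation_ofD(5)[OF orientation_tree_arcs[OF assms], of a] a unfolding tree_arcs_def by auto
    then show "a \<in> fourientation_neg (fourientation_compl G (internal_atlas_of G \<sigma> T))"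
      using \<open>a \<in> arcs G\<close> by (auto simp: fourientation_neg_def fourientation_compl_def)
  qed
  have "one_way (tree_arcs \<sigma> T) (arc_edge a)" if "a \<in> tree_arcs \<sigma> T" for a
    using orientation_tree_arcs[OF assms] that unfolding orientation_of_def by blast
  then have "{a \<in> tree_arcs \<sigma> T. arc_head a = v \<and> one_way (tree_arcs \<sigma> T) (arc_edge a)} = {a \<in> tree_arcs \<sigma> T. arc_head a = v}" for v
    by blast
  then show ?thesis
    unfolding I_sig_def F div_plus_def fourientation_div_def indeg_def break_div_def by simp
qed

text \<open>The arcs off T and the tree arcs are glued to a full orientation, whose indegrees are
  the sum of the two contributions. In this form two elements can be compared along cuts, whatever
  their trees are.\<close>

lemma BD_iff:
  assumes "cocycle_signature G \<sigma>"
  shows "E \<in> BD G (I_sig G q \<sigma>) \<longleftrightarrow>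
    (\<exists>T\<in>spanning_trees G. \<exists>F. orientation_of G (edges G) F \<and> F \<subseteq> internal_atlas_of G \<sigma> T \<and>
       E = (\<lambda>v. break_div F v - 1 + chip q v))"
proof
  assume "E \<in> BD G (I_sig G q \<sigma>)"
  then obtain T B where T: "T \<in> spanning_trees G" and B: "orientation_of G (edges G - T) B"
    and E: "E = break_div B \<oplus>\<^sub>D I_sig G q \<sigma> T"
    unfolding BD_def by blast
  note tr = orientation_tree_arcs[OF assms T]
  have disj: "B \<inter> tree_arcs \<sigma> T = {}" using orientation_ofD(2)[OF B] by (auto simp: tree_arcs_def)
  have "orientation_of G (edges G) (B \<union> tree_arcs \<sigma> T)"
    unfolding orientation_of_def
  proof (intro conjI ballI)
    show sub: "B \<union> tree_arcs \<sigma> T \<subseteq> arcs G" using orientation_ofD(1) B tr by blast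
    show "arc_edge ` (B \<union> tree_arcs \<sigma> T) \<subseteq> edges G" using sub arc_edge_in_edges by blast
    fix e assume e: "e \<in> edges G"
    show "one_way (B \<union> tree_arcs \<sigma> T) e"
    proof (rule one_wayI[OF sub e])
      fix a assume a: "a \<in> arcs G" "arc_edge a = e"
      then show "(arc_rev a \<in> B \<union> tree_arcs \<sigma> T) = (a \<notin> B \<union> tree_arcs \<sigma> T)"
        using orientation_ofD(2,5)[OF B] orientation_ofD(2,5)[OF tr] e
        by (metis Diff_iff Un_iff arc_rev_simps(1))
    qed
  qed
  moreover have "B \<union> tree_arcs \<sigma> T \<subseteq> internal_atlas_of G \<sigma> T"
    using orientation_ofD(1,2)[OF B] internal_atlas_off_tree[of _ T \<sigma>] by (fastforce simp: tree_arcs_def)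
  moreover have "E = (\<lambda>v. break_div (B \<union> tree_arcs \<sigma> T) v - 1 + chip q v)"
    unfolding E I_sig_eq[OF assms T] div_plus_def break_div_disjoint_Un[OF disj] by auto
  ultimately show "\<exists>T\<in>spanning_trees G. \<exists>F. orientation_of G (edges G) F \<and> F \<subseteq> internal_atlas_of G \<sigma> T \<and>
       E = (\<lambda>v. break_div F v - 1 + chip q v)" using T by blast
next
  assume "\<exists>T\<in>spanning_trees G. \<exists>F. orientation_of G (edges G) F \<and> F \<subseteq> internal_atlas_of G \<sigma> T \<and>
       E = (\<lambda>v. break_div F v - 1 + chip q v)"
  then obtain T F where T: "T \<in> spanning_trees G" and O: "orientation_of G (edges G) F"
    and sub: "F \<subseteq> internal_atlas_of G \<sigma> T" and E: "E = (\<lambda>v. break_div F v - 1 + chip q v)" by blast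
  note tr = orientation_tree_arcs[OF assms T]
  define B where "B = {a \<in> F. arc_edge a \<notin> T}"
  have F: "F = B \<union> tree_arcs \<sigma> T"
  proof (intro subset_antisym subsetI)
    fix a assume "a \<in> B \<union> tree_arcs \<sigma> T"
    \<comment> \<open>\<open>F\<close> contains an arc of every tree edge, and the internally
      oriented tree offers only one, so \<open>F\<close> contains all tree arcs.\<close>
    moreover have "a \<in> F" if a: "a \<in> tree_arcs \<sigma> T"
    proof (rule ccontr)
      assume "a \<notin> F"
      moreover have aa: "a \<in> arcs G" "arc_edge a \<in> T" using orientation_ofD(1,2)[OF tr] a by auto
      ultimately have "arc_rev a \<in> F" using orientation_ofD(5)[OF O, of a] arc_edge_in_edges by blast
      then have "arc_rev a \<in> tree_arcs \<sigma> T" using sub aa by (auto simp: tree_arcs_def)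
      then show False using orientation_ofD(5)[OF tr aa] a by blast
    qed
    ultimately show "a \<in> F" by (auto simp: B_def)
  qed (use sub in \<open>auto simp: B_def tree_arcs_def\<close>)
  have disj: "B \<inter> tree_arcs \<sigma> T = {}" by (auto simp: B_def tree_arcs_def)
  have "orientation_of G (edges G - T) B"
    using O unfolding orientation_of_def B_def one_way_def by auto
  moreover have "E = break_div B \<oplus>\<^sub>D I_sig G q \<sigma> T"
    unfolding E I_sig_eq[OF assms T] div_plus_def F break_div_disjoint_Un[OF disj] by auto
  ultimately show "E \<in> BD G (I_sig G q \<sigma>)" using T unfolding BD_def by blast
qed

lemma degree_orientation_div:
  assumes "orientation_of G S F"
  shows "degree_div (\<lambda>v. break_div F v - 1 + chip q v) = int (card S) - int CARD('v) + 1"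
  using degree_break_div[OF assms] unfolding degree_div_def chip_def
  by (simp add: sum.distrib sum_subtractf)

lemma I_sig_Div0:
  assumes "cocycle_signature G \<sigma>" "T \<in> spanning_trees G"
  shows "I_sig G q \<sigma> T \<in> Div 0"
  using degree_orientation_div[OF orientation_tree_arcs[OF assms]] card_spanning_tree[OF assms(2)]
  unfolding Div_def I_sig_eq[OF assms] by simp

lemma BD_degree:
  assumes "cocycle_signature G \<sigma>" "E \<in> BD G (I_sig G q \<sigma>)"
  shows "E \<in> Div (genus G)"
  using assms(2) degree_orientation_div unfolding BD_iff[OF assms(1)] Div_def genus_def by auto

lemma BD_equivalent_eq:
  assumes "cocycle_signature G \<sigma>" "triangulating G \<sigma>"
    and "E1 \<in> BD G (I_sig G q \<sigma>)" "E2 \<in> BD G (I_sig G q \<sigma>)" "linearly_equivalent G E1 E2"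
  shows "E1 = E2"
proof -
  obtain T1 F1 where 1: "T1 \<in> spanning_trees G" "orientation_of G (edges G) F1" "F1 \<subseteq> internal_atlas_of G \<sigma> T1"
       "E1 = (\<lambda>v. break_div F1 v - 1 + chip q v)"
    using assms(3) unfolding BD_iff[OF assms(1)] by blast
  obtain T2 F2 where 2: "T2 \<in> spanning_trees G" "orientation_of G (edges G) F2" "F2 \<subseteq> internal_atlas_of G \<sigma> T2"
       "E2 = (\<lambda>v. break_div F2 v - 1 + chip q v)"
    using assms(4) unfolding BD_iff[OF assms(1)] by blast
  obtain f where f: "E2 = (\<lambda>w. E1 w + lap G f w)" using assms(5) unfolding linearly_equivalent_iff_lap by blast
  have eq: "break_div F2 v = break_div F1 v + lap G f v" for v
    using fun_cong[OF f, of v] 1(4) 2(4) by simp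
  have const: "f x = f y" for x y
  proof (rule ccontr)
    assume "f x \<noteq> f y"
    from equivalent_orientations[OF 1(2) 2(2) eq this] show False
      using no_opposite_cuts[OF assms(2) 1(1) 2(1)] 1(3) 2(3) by (metis order_trans)
  qed
  have "lap G f w = 0" for w
    unfolding lap_def by (intro sum.neutral ballI) (metis const diff_self)
  with f show ?thesis by simp
qed

lemma orientation_tree_pair:
  assumes "cocycle_signature G \<sigma>" "T \<in> spanning_trees G" "externally_oriented G T X"
  shows "orientation_of G (edges G) (X \<inter> internal_atlas_of G \<sigma> T)"
  unfolding orientation_of_def
proof (intro conjI ballI)
  show sub: "X \<inter> internal_atlas_of G \<sigma> T \<subseteq> arcs G" using internal_atlas_subset by blast
  show "arc_edge ` (X \<inter> internal_atlas_of G \<sigma> T) \<subseteq> edges G" using sub arc_edge_in_edges by blast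
  fix e assume e: "e \<in> edges G"
  show "one_way (X \<inter> internal_atlas_of G \<sigma> T) e"
  proof (rule one_wayI[OF sub e])
    fix a assume a: "a \<in> arcs G" "arc_edge a = e"
    show "(arc_rev a \<in> X \<inter> internal_atlas_of G \<sigma> T) = (a \<notin> X \<inter> internal_atlas_of G \<sigma> T)"
    proof (cases "e \<in> T")
      case True
      then have "a \<in> X" "arc_rev a \<in> X"
        using assms(3) a unfolding externally_oriented_def bioriented_def by auto
      then show ?thesis
        using one_way_rev_iff[of "internal_atlas_of G \<sigma> T" a] one_way_internal_atlas[OF assms(1,2) True] a
          internal_atlas_subset by blast
    next
      case False
      then have "one_way X e" using assms(3) e unfolding externally_oriented_def by auto
      then have "arc_rev a \<in> X \<longleftrightarrow> a \<notin> X"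
        using one_way_rev_iff[of X a] a assms(3) unfolding externally_oriented_def fourientation_def by blast
      then show ?thesis using internal_atlas_off_tree a False by auto
    qed
  qed
qed

lemma fourientation_div_orientation:
  assumes "orientation_of G (edges G) F"
  shows "fourientation_div F \<oplus>\<^sub>D chip q = (\<lambda>v. break_div F v - 1 + chip q v)"
proof -
  have "one_way F (arc_edge a)" if "a \<in> F" for a
    using assms that unfolding orientation_of_def by blast
  then have "{a \<in> F. arc_head a = v \<and> one_way F (arc_edge a)} = {a \<in> F. arc_head a = v}" for v by blast
  then show ?thesis unfolding fourientation_div_def indeg_def div_plus_def break_div_def by simp
qed

end

section \<open>Reduced divisors and spanning trees\<close>

text \<open>The arcs are taken as entering W at v; by reversal their number is that of the chips v
  loses when W fires.\<close>

definition out_degree :: "('v, 'e) multigraph \<Rightarrow> 'v set \<Rightarrow> 'v \<Rightarrow> int" where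
  "out_degree G W v = int (card {a \<in> cut_in G W. arc_head a = v})"

definition q_reduced :: "('v, 'e) multigraph \<Rightarrow> 'v \<Rightarrow> 'v divisor \<Rightarrow> bool" where
  "q_reduced G q D \<longleftrightarrow> (\<forall>v. v \<noteq> q \<longrightarrow> 0 \<le> D v) \<and>
     (\<forall>W. W \<noteq> {} \<and> q \<notin> W \<longrightarrow> (\<exists>v\<in>W. D v < out_degree G W v))"

lemma lap_indicator_in:
  fixes G :: "('v::finite, 'e::finite) multigraph"
  assumes "v \<in> W"
  shows "lap G (indicator W) v = - out_degree G W v"
proof -
  have "lap G (indicator W) v = (\<Sum>a | a \<in> arcs G \<and> arc_head a = v. if arc_tail a \<in> W then 0 else - 1)"
    unfolding lap_def using assms by (intro sum.cong) (auto simp: indicator_def)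
  also have "\<dots> = - int (card ({a. a \<in> arcs G \<and> arc_head a = v} \<inter> - {a. arc_tail a \<in> W}))"
    by (subst sum.If_cases) auto
  also have "{a. a \<in> arcs G \<and> arc_head a = v} \<inter> - {a. arc_tail a \<in> W} = {a \<in> cut_in G W. arc_head a = v}"
    using assms unfolding cut_in_def by blast
  finally show ?thesis unfolding out_degree_def .
qed

lemma lap_zero_nonneg: "f v = 0 \<Longrightarrow> (\<And>u. 0 \<le> f u) \<Longrightarrow> 0 \<le> lap G f v"
  unfolding lap_def by (intro sum_nonneg) simp

lemma lap_indicator_out: "v \<notin> W \<Longrightarrow> 0 \<le> lap G (indicator W) v"
  by (rule lap_zero_nonneg) (auto simp: indicator_def)

section \<open>Existence of reduced divisors\<close>

context conn_graph
begin

lemma connected_edges: "connected_by G UNIV (edges G)"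
  using connected unfolding connected_graph_def .

text \<open>Provides a script that gives a chip to every vertex except possibly q; its multiples pay
  off any debt away from q. The script is built by enlarging the set of supplied vertices from q
  outwards.\<close>

lemma exists_positive_lap: "\<exists>f. \<forall>v. v \<noteq> q \<longrightarrow> 1 \<le> lap G f v"
proof -
  define P where "P B \<longleftrightarrow> (\<exists>f. (\<forall>v. 0 \<le> f v) \<and> (\<forall>v. v \<notin> B \<longrightarrow> f v = 0) \<and> (\<forall>v\<in>B - {q}. 1 \<le> lap G f v))" for B
  have "P UNIV"
  proof (rule connected_by_grow[OF connected_edges order_refl, of P q])
    show "P {q}" unfolding P_def by (intro exI[of _ "\<lambda>_. 0"]) auto
    fix B a assume "P B" and a: "a \<in> arcs G" "arc_tail a \<in> B" "arc_head a \<notin> B"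
    then obtain f where f: "\<And>v. 0 \<le> f v" "\<And>v. v \<notin> B \<Longrightarrow> f v = 0" "\<And>v. v \<in> B - {q} \<Longrightarrow> 1 \<le> lap G f v"
      unfolding P_def by blast
    define m where "m = int (card (arcs G))"
    \<comment> \<open>Firing B once supplies the new vertex but costs each vertex of B at most m
      chips; repeating the old script m + 1 times leaves a gain of at least 1 there.\<close>
    define g where "g = (\<lambda>x. (m + 1) * f x + indicator B x)"
    have lap_g: "lap G g v = (m + 1) * lap G f v + lap G (indicator B) v" for v
      unfolding g_def lap_add lap_mult ..
    have "out_degree G B v \<le> m" for v
    proof -
      have "card {a \<in> cut_in G B. arc_head a = v} \<le> card (arcs G)" by (rule card_mono) (auto simp: cut_in_def)
      then show ?thesis unfolding out_degree_def m_def by simp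
    qed
    then have inB: "1 \<le> lap G g v" if "v \<in> B - {q}" for v
    proof -
      have "(m + 1) * 1 \<le> (m + 1) * lap G f v"
        by (rule mult_left_mono) (use f(3)[OF that] in \<open>auto simp: m_def\<close>)
      then show ?thesis using lap_indicator_in[of v B G] that \<open>out_degree G B v \<le> m\<close> unfolding lap_g by auto
    qed
    have "1 \<le> lap G g (arc_head a)"
    proof -
      have "(\<Sum>b\<in>{a}. indicator B (arc_tail b) - indicator B (arc_head a) :: int) \<le> lap G (indicator B) (arc_head a)"
        unfolding lap_def by (rule sum_mono2) (use a in \<open>auto simp: indicator_def\<close>)
      moreover have "0 \<le> (m + 1) * lap G f (arc_head a)"
        using lap_zero_nonneg[of f "arc_head a" G, OF f(2)[OF a(3)] f(1)] by (intro mult_nonneg_nonneg) (simp_all add: m_def)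
      ultimately show ?thesis unfolding lap_g using a by (simp add: indicator_def)
    qed
    moreover have "0 \<le> g v" for v using f(1) unfolding g_def m_def by auto
    moreover have "g v = 0" if "v \<notin> B" for v using f(2) that unfolding g_def by auto
    ultimately show "P (insert (arc_head a) B)" using inB unfolding P_def by (intro exI[of _ g]) auto
  qed
  then show ?thesis unfolding P_def by auto
qed

text \<open>Consider the scripts that vanish at q and leave no debt elsewhere. One of maximal total
  is reduced: a set W violating the condition could be fired once more. The work lies in bounding
  these scripts from above.\<close>

lemma exists_reduced: "\<exists>D'. linearly_equivalent G D D' \<and> q_reduced G q D'"
proof -
  define F where "F = {f. f q = 0 \<and> (\<forall>v. v \<noteq> q \<longrightarrow> 0 \<le> D v + lap G f v)}"
  define K where "K = (\<Sum>v\<in>UNIV. \<bar>D v\<bar>)"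
  have K: "0 \<le> K" "\<bar>D v\<bar> \<le> K" "sum D W \<le> K" for v W
  proof -
    show "0 \<le> K" unfolding K_def by (simp add: sum_nonneg)
    show "\<bar>D v\<bar> \<le> K" unfolding K_def by (rule member_le_sum) auto
    have "sum D W \<le> (\<Sum>v\<in>W. \<bar>D v\<bar>)" by (rule sum_mono) simp
    also have "\<dots> \<le> K" unfolding K_def by (rule sum_mono2) auto
    finally show "sum D W \<le> K" .
  qed
  obtain f0 where f0: "\<And>v. v \<noteq> q \<Longrightarrow> 1 \<le> lap G f0 v" using exists_positive_lap by blast
  \<comment> \<open>K bounds every debt of \<open>D\<close>, so K copies of \<open>f0\<close>
    suffice; subtracting the value at q makes the script vanish there and does not change its
    effect.\<close>
  define f1 where "f1 = (\<lambda>v. K * (f0 v + (- f0 q)))"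
  have "f1 \<in> F"
  proof -
    have "0 \<le> D v + lap G f1 v" if "v \<noteq> q" for v
    proof -
      have "lap G f1 v = K * lap G f0 v" unfolding f1_def lap_mult lap_add lap_const by simp
      moreover have "K * 1 \<le> K * lap G f0 v" using f0[OF that] K(1) by (intro mult_left_mono) auto
      ultimately show ?thesis using K(2)[of v] by linarith
    qed
    then show ?thesis unfolding F_def f1_def by auto
  qed
  have arc_bound: "f (arc_head a) \<le> max 0 (f (arc_tail a)) + K" if f: "f \<in> F" and a: "a \<in> arcs G" for f a
  proof (rule ccontr)
    assume n: "\<not> ?thesis"
    \<comment> \<open>All vertices that fire at least as often as the head of a. Through a alone W
      would lose more than K chips, no arc of the cut brings chips in, and K bounds what
      \<open>D\<close> has on W.\<close>
    define W where "W = {v. f (arc_head a) \<le> f v}"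
    have fq: "f q = 0" and fF: "\<And>v. v \<noteq> q \<Longrightarrow> 0 \<le> D v + lap G f v" using f unfolding F_def by auto
    have "q \<notin> W" using n K(1) fq unfolding W_def by auto
    have "0 \<le> (\<Sum>v\<in>W. D v + lap G f v)"
      using \<open>q \<notin> W\<close> fF by (intro sum_nonneg) metis
    also have "\<dots> = sum D W + (\<Sum>b\<in>cut_in G W. f (arc_tail b) - f (arc_head b))"
      unfolding sum.distrib sum_lap ..
    also have "(\<Sum>b\<in>cut_in G W. f (arc_tail b) - f (arc_head b)) \<le> (\<Sum>b\<in>{a}. f (arc_tail b) - f (arc_head b))"
    proof -
      have "a \<in> cut_in G W" using a n K(1) unfolding cut_in_def W_def by auto
      moreover have "f (arc_tail b) - f (arc_head b) \<le> 0" if "b \<in> cut_in G W" for b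
        using that unfolding cut_in_def W_def by auto
      ultimately show ?thesis
        using sum_mono2[of "cut_in G W" "{a}" "\<lambda>b. f (arc_head b) - f (arc_tail b)"]
        by (simp add: sum_subtractf)
    qed
    finally show False using K(3)[of W] n by auto
  qed
  define P where "P B \<longleftrightarrow> (\<exists>b\<ge>0. \<forall>f\<in>F. \<forall>v\<in>B. f v \<le> b)" for B
  have "P UNIV"
  proof (rule connected_by_grow[OF connected_edges order_refl, of P q])
    show "P {q}" unfolding P_def F_def by auto
    fix B a assume "P B" and a: "a \<in> arcs G" "arc_tail a \<in> B" "arc_head a \<notin> B"
    then obtain b where b: "0 \<le> b" "\<And>f v. f \<in> F \<Longrightarrow> v \<in> B \<Longrightarrow> f v \<le> b" unfolding P_def by blast
    have "f v \<le> b + K" if "f \<in> F" "v \<in> insert (arc_head a) B" for f v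
    proof (cases "v \<in> B")
      case True
      then show ?thesis using b(2)[OF that(1) True] K(1) by linarith
    next
      case False
      then have "f v \<le> max 0 (f (arc_tail a)) + K" using arc_bound[OF that(1) a(1)] that(2) by simp
      then show ?thesis using b(2)[OF that(1) a(2)] b(1) by linarith
    qed
    then show "P (insert (arc_head a) B)" unfolding P_def using b(1) K(1) by (intro exI[of _ "b + K"]) auto
  qed
  then obtain b where b: "\<And>f v. f \<in> F \<Longrightarrow> f v \<le> b" unfolding P_def by auto
  define s where "s f = (\<Sum>v\<in>UNIV. f v)" for f :: "'v \<Rightarrow> int"
  define C where "C = (\<Sum>v\<in>(UNIV :: 'v set). b)"
  have sC: "s f \<le> C" if "f \<in> F" for f unfolding s_def C_def using b[OF that] by (rule sum_mono)
  \<comment> \<open>The total is maximized by minimizing its distance to the upper bound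
    \<open>C\<close>, which is a natural number.\<close>
  have "\<exists>f. f \<in> F \<and> (\<forall>g. g \<in> F \<longrightarrow> nat (C - s f) \<le> nat (C - s g))"
    using ex_has_least_nat[of "\<lambda>f. f \<in> F" f1 "\<lambda>f. nat (C - s f)", OF \<open>f1 \<in> F\<close>] .
  then obtain f where f: "f \<in> F" and least: "\<And>g. g \<in> F \<Longrightarrow> nat (C - s f) \<le> nat (C - s g)" by auto
  have max: "s g \<le> s f" if "g \<in> F" for g
    using least[OF that] sC[OF that] sC[OF f] by simp
  define D' where "D' = (\<lambda>v. D v + lap G f v)"
  have "\<exists>v\<in>W. D' v < out_degree G W v" if W: "W \<noteq> {}" "q \<notin> W" for W
  proof (rule ccontr)
    assume n: "\<not> ?thesis"
    define g where "g = (\<lambda>v. f v + indicator W v)"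
    have "0 \<le> D v + lap G g v" if "v \<noteq> q" for v
    proof (cases "v \<in> W")
      case True
      then have "out_degree G W v \<le> D v + lap G f v" using n unfolding D'_def by (meson not_less)
      then show ?thesis using lap_indicator_in[OF True, of G] unfolding g_def lap_add by linarith
    next
      case False
      have "0 \<le> D v + lap G f v" using f that unfolding F_def by auto
      then show ?thesis using lap_indicator_out[OF False, of G] unfolding g_def lap_add by linarith
    qed
    then have "g \<in> F" using f W unfolding F_def g_def by (auto simp: indicator_def)
    then have "s g \<le> s f" by (rule max)
    moreover have "s g = s f + int (card W)"
      unfolding s_def g_def sum.distrib by (simp add: indicator_def sum.If_cases)
    moreover have "card W > 0" using W by (simp add: card_gt_0_iff)
    ultimately show False by linarith
  qed
  then have "q_reduced G q D'" using f unfolding q_reduced_def D'_def F_def by auto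
  then show ?thesis using linearly_equivalent_add_lap unfolding D'_def by blast
qed

text \<open>
  Dhar's burning algorithm, turned into a recursion: \<open>B\<close> is the set of burnt vertices,
  \<open>P\<close> the set of burnt edges.  When an edge from \<open>B\<close> to a vertex \<open>v\<close> outside burns,
  either \<open>v\<close> has exactly as many chips as it had burnt edges before, and then \<open>v\<close> burns and the
  edge joins the tree, or it has more chips and the edge does not join the tree.
\<close>

definition configurations :: "'v set \<Rightarrow> 'e set \<Rightarrow> ('v \<Rightarrow> int) set" where
  "configurations B P = {c. (\<forall>v\<in>B. c v = 0) \<and> (\<forall>v. v \<notin> B \<longrightarrow> int (card {e \<in> P. v \<in> ends G e}) \<le> c v) \<and>
     (\<forall>W. W \<noteq> {} \<and> W \<inter> B = {} \<longrightarrow> (\<exists>v\<in>W. c v < out_degree G W v))}"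

text \<open>Deletion and contraction: for an unburnt edge e leaving B, the trees on the right split
  by whether they contain e, just as the configurations split by whether its outer end v burns. The
  invariants on T make it a spanning tree once B is everything.\<close>

lemma configurations_bound:
  assumes "P \<subseteq> edges G" "T \<subseteq> P" "connected_by G B T" "card T + 1 = card B"
  shows "finite (configurations B P) \<and>
    card (configurations B P) \<le> card {T' \<in> spanning_trees G. T' \<inter> P = T}"
  using assms
proof (induction "card (edges G - P)" arbitrary: B P T rule: less_induct)
  case less
  show ?case
  proof (cases "\<exists>a\<in>arcs G. arc_edge a \<notin> P \<and> arc_tail a \<in> B \<and> arc_head a \<notin> B")
    case True
    then obtain a where a: "a \<in> arcs G" "arc_edge a \<notin> P" "arc_tail a \<in> B" "arc_head a \<notin> B" by blast
    define e v P' where "e = arc_edge a" and "v = arc_head a" and "P' = insert e P"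
    have e: "e \<in> edges G" "e \<notin> P" "ends G e = {arc_tail a, v}"
      using a unfolding e_def v_def arcs_def by auto
    have smaller: "card (edges G - P') < card (edges G - P)"
      unfolding P'_def using e by (intro psubset_card_mono) auto
    have P': "P' \<subseteq> edges G" using e less.prems P'_def by auto
    have "connected_by G (insert v B) (insert e T)"
    proof -
      have old: "(x, y) \<in> (adj G (insert e T))\<^sup>*" if "x \<in> B" "y \<in> B" for x y
        using less.prems(3) that rtrancl_mono[OF adj_mono[of T "insert e T" G]] unfolding connected_by_def by blast
      have "(arc_tail a, v) \<in> adj G (insert e T)" using e by (auto simp: adj_def)
      then have new: "(x, v) \<in> (adj G (insert e T))\<^sup>*" if "x \<in> B" for x
        using old[OF that a(3)] by (rule rtrancl_into_rtrancl[rotated])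
      show ?thesis unfolding connected_by_def
      proof (intro conjI ballI)
        fix x y assume "x \<in> insert v B" "y \<in> insert v B"
        then show "(x, y) \<in> (adj G (insert e T))\<^sup>*"
          using old new adj_rtrancl_sym[OF new] by blast
      qed simp
    qed
    moreover have "card (insert e T) + 1 = card (insert v B)"
      using less.prems e a unfolding v_def by (subst (1 2) card_insert_disjoint) auto
    ultimately have IH1: "finite (configurations (insert v B) P')"
      "card (configurations (insert v B) P') \<le> card {T' \<in> spanning_trees G. T' \<inter> P' = insert e T}"
      using less.hyps[OF smaller P', of "insert e T" "insert v B"] less.prems(2) unfolding P'_def by auto
    have IH2: "finite (configurations B P')" "card (configurations B P') \<le> card {T' \<in> spanning_trees G. T' \<inter> P' = T}"
      using less.hyps[OF smaller P', of T B] less.prems unfolding P'_def by auto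
    define k where "k = int (card {f \<in> P. v \<in> ends G f})"
    have burnt_v: "int (card {f \<in> P'. v \<in> ends G f}) = k + 1"
    proof -
      have "{f \<in> P'. v \<in> ends G f} = insert e {f \<in> P. v \<in> ends G f}" using e unfolding P'_def by auto
      then show ?thesis using e(2) unfolding k_def by simp
    qed
    have burnt_other: "{f \<in> P'. u \<in> ends G f} = {f \<in> P. u \<in> ends G f}" if "u \<notin> B" "u \<noteq> v" for u
      using e a(3) that unfolding P'_def by auto
    define C1 C2 where "C1 = {c \<in> configurations B P. c v = k}" and "C2 = {c \<in> configurations B P. k + 1 \<le> c v}"
    have "k \<le> c v" if "c \<in> configurations B P" for c
      using that a(4) unfolding configurations_def k_def v_def by blast
    then have C: "configurations B P = C1 \<union> C2" unfolding C1_def C2_def by force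
    have "C2 \<subseteq> configurations B P'"
    proof
      fix c assume c: "c \<in> C2"
      have "int (card {f \<in> P'. u \<in> ends G f}) \<le> c u" if "u \<notin> B" for u
      proof (cases "u = v")
        case True
        then show ?thesis using c burnt_v unfolding C2_def by simp
      next
        case False
        then show ?thesis using c that unfolding C2_def configurations_def burnt_other[OF that False] by blast
      qed
      then show "c \<in> configurations B P'" using c unfolding C2_def configurations_def by blast
    qed
    then have C2: "finite C2" "card C2 \<le> card {T' \<in> spanning_trees G. T' \<inter> P' = T}"
      using finite_subset[OF _ IH2(1)] card_mono[OF IH2(1), of C2] IH2(2) by auto
    \<comment> \<open>On \<open>C1\<close> the value at v is the fixed number k, so nothing is lost
      by erasing it; burnt vertices must carry the value 0 in \<open>configurations\<close>.\<close>
    have inj: "inj_on (\<lambda>c. c(v := 0)) C1"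
    proof (rule inj_onI)
      fix c c' assume c: "c \<in> C1" "c' \<in> C1" "c(v := 0) = c'(v := 0)"
      have "c u = c' u" for u
      proof (cases "u = v")
        case True
        then show ?thesis using c unfolding C1_def by simp
      next
        case False
        then show ?thesis using fun_cong[OF c(3), of u] by simp
      qed
      then show "c = c'" ..
    qed
    have sub1: "(\<lambda>c. c(v := 0)) ` C1 \<subseteq> configurations (insert v B) P'"
    proof
      fix c' assume "c' \<in> (\<lambda>c. c(v := 0)) ` C1"
      then obtain c where c: "c \<in> configurations B P" "c' = c(v := 0)" unfolding C1_def by auto
      have zero: "\<forall>u\<in>insert v B. c' u = 0" using c unfolding configurations_def by auto
      have le: "int (card {f \<in> P'. u \<in> ends G f}) \<le> c' u" if "u \<notin> insert v B" for u
      proof -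
        have u: "u \<notin> B" "u \<noteq> v" using that by auto
        then show ?thesis using c unfolding configurations_def burnt_other[OF u] by auto
      qed
      have red: "\<exists>u\<in>W. c' u < out_degree G W u" if W: "W \<noteq> {}" "W \<inter> insert v B = {}" for W
      proof -
        have "W \<inter> B = {}" using W(2) by auto
        then obtain u where u: "u \<in> W" "c u < out_degree G W u"
          using c(1) W(1) unfolding configurations_def by blast
        then show ?thesis using W(2) c(2) by (intro bexI[of _ u]) auto
      qed
      show "c' \<in> configurations (insert v B) P'"
        unfolding configurations_def
      proof (intro CollectI conjI allI impI)
        fix u assume "u \<notin> insert v B"
        then show "int (card {f \<in> P'. u \<in> ends G f}) \<le> c' u" by (rule le)
      next
        fix W assume "W \<noteq> {} \<and> W \<inter> insert v B = {}"
        then show "\<exists>u\<in>W. c' u < out_degree G W u" by (elim conjE) (rule red)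
      qed (rule zero)
    qed
    have fin1: "finite C1" by (rule finite_imageD[OF finite_subset[OF sub1 IH1(1)] inj])
    have le1: "card C1 \<le> card {T' \<in> spanning_trees G. T' \<inter> P' = insert e T}"
    proof -
      have "card C1 = card ((\<lambda>c. c(v := 0)) ` C1)" by (rule card_image[OF inj, symmetric])
      also have "\<dots> \<le> card (configurations (insert v B) P')" by (rule card_mono[OF IH1(1) sub1])
      also note IH1(2)
      finally show ?thesis .
    qed
    have "T' \<inter> P = T \<longleftrightarrow> T' \<inter> P' = insert e T \<or> T' \<inter> P' = T" for T'
      using e(2) less.prems(2) unfolding P'_def by (cases "e \<in> T'") auto
    then have "{T' \<in> spanning_trees G. T' \<inter> P = T} =
       {T' \<in> spanning_trees G. T' \<inter> P' = insert e T} \<union> {T' \<in> spanning_trees G. T' \<inter> P' = T}"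
      by (simp add: conj_disj_distribL Collect_disj_eq)
    moreover have "{T' \<in> spanning_trees G. T' \<inter> P' = insert e T} \<inter> {T' \<in> spanning_trees G. T' \<inter> P' = T} = {}"
      using e(2) less.prems(2) by auto
    ultimately have "card {T' \<in> spanning_trees G. T' \<inter> P = T} =
       card {T' \<in> spanning_trees G. T' \<inter> P' = insert e T} + card {T' \<in> spanning_trees G. T' \<inter> P' = T}"
      by (simp add: card_Un_disjoint)
    then show ?thesis using C fin1 le1 C2 card_Un_le[of C1 C2] by simp
  next
    case False
    show ?thesis
    proof (cases "B = UNIV")
      \<comment> \<open>Everything has burnt: only the zero function remains, and it is matched with
        T itself.\<close>
      case True
      then have "T \<in> spanning_trees G"
        using connected_by_tight_is_tree[of G T] less.prems by auto
      then have "{T} \<subseteq> {T' \<in> spanning_trees G. T' \<inter> P = T}" using less.prems(2) by auto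
      then have "card {T} \<le> card {T' \<in> spanning_trees G. T' \<inter> P = T}" by (intro card_mono) auto
      moreover have sub: "configurations B P \<subseteq> {\<lambda>_. 0}" unfolding configurations_def True by auto
      have "finite (configurations B P)" by (rule finite_subset[OF sub]) simp
      moreover have "card (configurations B P) \<le> card {\<lambda>_::'v. 0 :: int}" by (rule card_mono[OF _ sub]) simp
      ultimately show ?thesis by simp
    next
      case B: False
      \<comment> \<open>The fire has stopped early: every edge from B to v is burnt, so
        \<open>c v\<close> is at least the number of these edges, against the condition for the set
        \<open>- B\<close>.\<close>
      have "c \<notin> configurations B P" for c
      proof
        assume c: "c \<in> configurations B P"
        then obtain v where v: "v \<notin> B" "c v < out_degree G (- B) v"
        proof -
          have "- B \<noteq> {} \<and> - B \<inter> B = {}" using B by auto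
          then have "\<exists>v\<in>- B. c v < out_degree G (- B) v" using c unfolding configurations_def by simp
          then show thesis using that by auto
        qed
        let ?A = "{a \<in> cut_in G (- B). arc_head a = v}"
        have "inj_on arc_edge ?A"
          using arc_same_edge arc_tail_neq_head unfolding cut_in_def
          by (intro inj_onI) (metis (no_types, lifting) arc_rev_simps(3) mem_Collect_eq)
        moreover have "arc_edge ` ?A \<subseteq> {e \<in> P. v \<in> ends G e}"
          using False unfolding cut_in_def arcs_def by auto
        ultimately have "card ?A \<le> card {e \<in> P. v \<in> ends G e}" by (intro card_inj_on_le[of arc_edge]) simp_all
        moreover have "int (card {e \<in> P. v \<in> ends G e}) \<le> c v" using c v unfolding configurations_def by blast
        ultimately show False using v(2) unfolding out_degree_def by linarith
      qed
      then have "configurations B P = {}" by blast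
      then show ?thesis by simp
    qed
  qed
qed

text \<open>The value at q can be recovered from the degree, so it may be set to 0. What remains is
  a configuration for the start of the fire: q burnt, no edge burnt.\<close>

lemma card_reduced_le:
  "finite {D \<in> Div d. q_reduced G q D}" (is "finite ?R")
  "card {D \<in> Div d. q_reduced G q D} \<le> card (spanning_trees G)"
proof -
  have bound: "finite (configurations {q} {})" "card (configurations {q} {}) \<le> card (spanning_trees G)"
    using configurations_bound[of "{}" "{}" "{q}"] by (auto simp: connected_by_def)
  have inj: "inj_on (\<lambda>D. D(q := 0)) ?R"
  proof (rule inj_onI)
    fix D D' :: "'v divisor"
    assume D: "D \<in> ?R" "D' \<in> ?R" and eq: "D(q := 0) = D'(q := 0)"
    have other: "D v = D' v" if "v \<noteq> q" for v using fun_cong[OF eq, of v] that by simp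
    have "degree_div E = E q + (\<Sum>v\<in>UNIV - {q}. E v)" for E
      unfolding degree_div_def by (subst sum.remove[of UNIV q]) auto
    moreover have "(\<Sum>v\<in>UNIV - {q}. D v) = (\<Sum>v\<in>UNIV - {q}. D' v)" using other by (intro sum.cong) auto
    moreover have "degree_div D = degree_div D'" using D unfolding Div_def by auto
    ultimately have "D q = D' q" by simp
    then show "D = D'" using other by (metis ext)
  qed
  have sub: "(\<lambda>D. D(q := 0)) ` ?R \<subseteq> configurations {q} {}"
  proof
    fix c assume "c \<in> (\<lambda>D. D(q := 0)) ` ?R"
    then obtain D where D: "q_reduced G q D" "c = D(q := 0)" by auto
    have "\<exists>v\<in>W. c v < out_degree G W v" if "W \<noteq> {}" "W \<inter> {q} = {}" for W
    proof -
      have "q \<notin> W" using that(2) by auto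
      then have "\<exists>v\<in>W. D v < out_degree G W v" using D(1) that(1) unfolding q_reduced_def by simp
      then obtain v where "v \<in> W" "D v < out_degree G W v" by blast
      moreover have "c v = D v" using D(2) \<open>q \<notin> W\<close> \<open>v \<in> W\<close> by auto
      ultimately show ?thesis using \<open>v \<in> W\<close> by (intro bexI[of _ v]) simp_all
    qed
    moreover have "c v = 0" if "v \<in> {q}" for v using D(2) that by simp
    moreover have "int (card {e \<in> {}. v \<in> ends G e}) \<le> c v" if "v \<notin> {q}" for v
      using D that unfolding q_reduced_def by simp
    ultimately show "c \<in> configurations {q} {}" unfolding configurations_def by blast
  qed
  show "finite ?R" using finite_imageD[OF finite_subset[OF sub bound(1)] inj] .
  have "card ?R = card ((\<lambda>D. D(q := 0)) ` ?R)" using card_image[OF inj] by simp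
  also have "\<dots> \<le> card (configurations {q} {})" by (rule card_mono[OF bound(1) sub])
  finally show "card ?R \<le> card (spanning_trees G)" using bound(2) by simp
qed

text \<open>Choosing reduced representatives embeds the trees into the reduced divisors of degree d.
  The upper bound on their number makes this embedding onto, so the representative of
  \<open>E\<close> is also that of some \<open>D T\<close>.\<close>

lemma inequivalent_family_complete:
  assumes deg: "\<And>T. T \<in> spanning_trees G \<Longrightarrow> D T \<in> Div d"
    and ineq: "\<And>T T'. T \<in> spanning_trees G \<Longrightarrow> T' \<in> spanning_trees G \<Longrightarrow>
      linearly_equivalent G (D T) (D T') \<Longrightarrow> T = T'"
    and E: "E \<in> Div d"
  shows "\<exists>T\<in>spanning_trees G. linearly_equivalent G E (D T)"
proof -
  \<comment> \<open>Burning may start at any vertex; an arbitrary one is fixed.\<close>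
  define q :: 'v where "q = undefined"
  define red where "red D = (SOME D'. linearly_equivalent G D D' \<and> q_reduced G q D')" for D
  have red: "linearly_equivalent G D (red D)" "q_reduced G q (red D)" for D
    using someI_ex[OF exists_reduced[of D q]] unfolding red_def by blast+
  let ?R = "{D \<in> Div d. q_reduced G q D}"
  have red_in: "red D \<in> ?R" if "D \<in> Div d" for D
  proof -
    obtain f where "red D = (\<lambda>w. D w + lap G f w)" using red(1) unfolding linearly_equivalent_iff_lap by blast
    then show ?thesis using red(2)[of D] that degree_div_add_lap[of D G f] unfolding Div_def by simp
  qed
  have "inj_on (\<lambda>T. red (D T)) (spanning_trees G)"
  proof (rule inj_onI)
    fix T T' assume T: "T \<in> spanning_trees G" "T' \<in> spanning_trees G" "red (D T) = red (D T')"
    then have "linearly_equivalent G (D T) (D T')"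
      using red(1) linearly_equivalent_sym linearly_equivalent_trans by metis
    then show "T = T'" using ineq T by blast
  qed
  then have "card ((\<lambda>T. red (D T)) ` spanning_trees G) = card (spanning_trees G)" by (rule card_image)
  moreover have "(\<lambda>T. red (D T)) ` spanning_trees G \<subseteq> ?R" using red_in deg by blast
  ultimately have "(\<lambda>T. red (D T)) ` spanning_trees G = ?R"
    using card_reduced_le[of d q] by (intro card_seteq) auto
  then obtain T where "T \<in> spanning_trees G" "red E = red (D T)" using red_in[OF E] by blast
  then show ?thesis using red(1) linearly_equivalent_sym linearly_equivalent_trans by metis
qed

end

section \<open>Circulations\<close>

text \<open>Weights are indexed by an arbitrary type with tail and head maps, so that parallel arcs
  and repeated arcs carry separate weights.\<close>

lemma flow_along_path:
  fixes t h :: "'i \<Rightarrow> 'v"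
  assumes "finite I" "(x, y) \<in> {(t i, h i) | i. i \<in> I}\<^sup>*"
  shows "\<exists>c. (\<forall>i. (0::real) \<le> c i) \<and>
    (\<forall>v. (\<Sum>i\<in>I. c i * (of_bool (h i = v) - of_bool (t i = v))) = of_bool (y = v) - of_bool (x = v))"
  using assms(2)
proof induction
  case base
  show ?case by (intro exI[of _ "\<lambda>_. 0"]) simp
next
  case (step y z)
  obtain i where i: "i \<in> I" "y = t i" "z = h i" using step(2) by blast
  obtain c :: "'i \<Rightarrow> real" where c: "\<forall>i. 0 \<le> c i"
      "\<forall>v. (\<Sum>i\<in>I. c i * (of_bool (h i = v) - of_bool (t i = v))) = of_bool (y = v) - of_bool (x = v)"
    using step.IH by auto
  define d where "d j = c j + of_bool (j = i)" for j
  have "(\<Sum>j\<in>I. d j * (of_bool (h j = v) - of_bool (t j = v))) = of_bool (z = v) - of_bool (x = v)" for v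
  proof -
    have "(\<Sum>j\<in>I. d j * (of_bool (h j = v) - of_bool (t j = v)))
      = (\<Sum>j\<in>I. c j * (of_bool (h j = v) - of_bool (t j = v))) +
        (\<Sum>j\<in>I. if j = i then of_bool (h j = v) - of_bool (t j = v) else 0)"
      unfolding sum.distrib[symmetric] d_def by (intro sum.cong) (auto simp: algebra_simps)
    also have "\<dots> = of_bool (z = v) - of_bool (x = v)"
      using c(2)[rule_format, of v] assms(1) i by (simp add: sum.delta)
    finally show ?thesis .
  qed
  then show ?case using c(1) by (intro exI[of _ d]) (simp add: d_def)
qed

text \<open>An exit from every proper set means strong connectivity, so each arc lies on a closed
  walk. Adding up one such walk per arc gives a circulation that is positive on all of them.\<close>

lemma positive_circulation:
  fixes t h :: "'i \<Rightarrow> 'v"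
  assumes "finite I" and exit: "\<And>W. W \<noteq> {} \<Longrightarrow> W \<noteq> UNIV \<Longrightarrow> \<exists>i\<in>I. t i \<in> W \<and> h i \<notin> W"
  shows "\<exists>c. (\<forall>i\<in>I. (0::real) < c i) \<and>
    (\<forall>v. (\<Sum>i\<in>I. c i * (of_bool (h i = v) - of_bool (t i = v))) = 0)"
proof -
  let ?r = "{(t i, h i) | i. i \<in> I}"
  have reach: "(x, y) \<in> ?r\<^sup>*" for x y
  proof (rule ccontr)
    assume n: "(x, y) \<notin> ?r\<^sup>*"
    define W where "W = {z. (x, z) \<in> ?r\<^sup>*}"
    have "x \<in> W" "y \<notin> W" using n unfolding W_def by auto
    then obtain i where i: "i \<in> I" "t i \<in> W" "h i \<notin> W" using exit[of W] by blast
    then have "(t i, h i) \<in> ?r" by blast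
    then show False using i unfolding W_def by (auto intro: rtrancl_into_rtrancl)
  qed
  define good where "good j c \<longleftrightarrow> (\<forall>i. (0::real) \<le> c i) \<and>
    (\<forall>v. (\<Sum>i\<in>I. c i * (of_bool (h i = v) - of_bool (t i = v))) = of_bool (t j = v) - of_bool (h j = v))" for j c
  have "\<exists>c. good j c" for j
    using flow_along_path[OF assms(1) reach[of "h j" "t j"]] unfolding good_def .
  then obtain k where k: "\<And>j. good j (k j)" by metis
  \<comment> \<open>\<open>k j\<close> returns one unit from the head of j to its tail; the extra
    unit on j closes the walk and makes the weight of j positive.\<close>
  define c where "c i = (\<Sum>j\<in>I. k j i + of_bool (i = j))" for i
  have pos: "0 < c i" if "i \<in> I" for i
  proof -
    have nn: "0 \<le> k j i" for j using k unfolding good_def by blast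
    have "(\<Sum>j\<in>{i}. k j i + of_bool (i = j)) \<le> c i"
      unfolding c_def by (rule sum_mono2) (use assms(1) that nn in auto)
    then show ?thesis using nn[of i] by simp
  qed
  have "(\<Sum>i\<in>I. c i * (of_bool (h i = v) - of_bool (t i = v))) = 0" for v
  proof -
    let ?b = "\<lambda>i. of_bool (h i = v) - of_bool (t i = v) :: real"
    have "(\<Sum>i\<in>I. c i * ?b i) = (\<Sum>i\<in>I. \<Sum>j\<in>I. k j i * ?b i + (if i = j then ?b i else 0))"
      unfolding c_def sum_distrib_right by (intro sum.cong) (auto simp: algebra_simps)
    also have "\<dots> = (\<Sum>j\<in>I. \<Sum>i\<in>I. k j i * ?b i + (if i = j then ?b i else 0))" by (rule sum.swap)
    also have "\<dots> = (\<Sum>j\<in>I. 0)"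
    proof (rule sum.cong[OF refl])
      fix j assume "j \<in> I"
      have "(\<Sum>i\<in>I. k j i * ?b i) = of_bool (t j = v) - of_bool (h j = v)" using k[of j] unfolding good_def by blast
      then show "(\<Sum>i\<in>I. k j i * ?b i + (if i = j then ?b i else 0)) = 0"
        using assms(1) \<open>j \<in> I\<close> by (simp add: sum.distrib sum.delta')
    qed
    finally show ?thesis by simp
  qed
  with pos show ?thesis by blast
qed

section \<open>Simplices of the Lawrence polytope\<close>

lemma convex_hull_image_weights:
  fixes p :: "'i \<Rightarrow> 'a::real_vector"
  assumes "finite I" "x \<in> convex hull (p ` I)"
  obtains u where "\<And>i. i \<in> I \<Longrightarrow> 0 \<le> u i" "sum u I = 1" "x = (\<Sum>i\<in>I. u i *\<^sub>R p i)"
proof -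
  define S where "S = {\<Sum>i\<in>I. u i *\<^sub>R p i | u. (\<forall>i\<in>I. (0::real) \<le> u i) \<and> sum u I = 1}"
  have "p ` I \<subseteq> S"
  proof
    fix y assume "y \<in> p ` I"
    then obtain j where j: "j \<in> I" "y = p j" by auto
    have "(\<Sum>i\<in>I. of_bool (i = j) *\<^sub>R p i) = (\<Sum>i\<in>I. if i = j then p i else 0)" by (intro sum.cong) auto
    then have "y = (\<Sum>i\<in>I. of_bool (i = j) *\<^sub>R p i)" using assms(1) j by (simp add: sum.delta)
    moreover have "(\<Sum>i\<in>I. of_bool (i = j)) = (1 :: real)"
      using sum.delta[OF assms(1), of j "\<lambda>_. 1 :: real"] j by (simp add: of_bool_def)
    ultimately show "y \<in> S" unfolding S_def by (intro CollectI exI[of _ "\<lambda>i. of_bool (i = j)"]) simp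
  qed
  moreover have "convex S"
  proof (rule convexI)
    fix y z and a b :: real assume "y \<in> S" "z \<in> S" and ab: "0 \<le> a" "0 \<le> b" "a + b = 1"
    then obtain u w where u: "\<forall>i\<in>I. 0 \<le> u i" "sum u I = 1" "y = (\<Sum>i\<in>I. u i *\<^sub>R p i)"
      and w: "\<forall>i\<in>I. 0 \<le> w i" "sum w I = 1" "z = (\<Sum>i\<in>I. w i *\<^sub>R p i)" unfolding S_def by blast
    have "a *\<^sub>R y + b *\<^sub>R z = (\<Sum>i\<in>I. (a * u i + b * w i) *\<^sub>R p i)"
      unfolding u(3) w(3) by (simp add: scaleR_sum_right sum.distrib scaleR_add_left)
    moreover have "(\<Sum>i\<in>I. a * u i + b * w i) = 1"
      using u(2) w(2) ab(3) by (simp add: sum.distrib sum_distrib_left[symmetric])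
    moreover have "\<forall>i\<in>I. 0 \<le> a * u i + b * w i" using u(1) w(1) ab by simp
    ultimately show "a *\<^sub>R y + b *\<^sub>R z \<in> S" unfolding S_def by (intro CollectI exI[of _ "\<lambda>i. a * u i + b * w i"]) simp
  qed
  ultimately have "convex hull (p ` I) \<subseteq> S" by (rule hull_minimal)
  then have "x \<in> S" using assms(2) by (rule subsetD)
  then show ?thesis using that unfolding S_def by auto
qed

lemma positive_combination_in_rel_interior:
  fixes p :: "'i \<Rightarrow> 'a::euclidean_space"
  assumes "finite I" and w: "\<And>i. i \<in> I \<Longrightarrow> 0 < w i" "sum w I = 1"
  shows "(\<Sum>i\<in>I. w i *\<^sub>R p i) \<in> rel_interior (convex hull (p ` I))" (is "?z \<in> rel_interior ?S")
proof -
  have "I \<noteq> {}" using w(2) by auto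
  have "\<exists>e>1. (1 - e) *\<^sub>R x + e *\<^sub>R ?z \<in> ?S" if x: "x \<in> ?S" for x
  proof -
    obtain u where u: "\<And>i. i \<in> I \<Longrightarrow> 0 \<le> u i" "sum u I = 1" "x = (\<Sum>i\<in>I. u i *\<^sub>R p i)"
      using convex_hull_image_weights[OF assms(1) x] by blast
    \<comment> \<open>The least weight tells how far the segment from x can be prolonged beyond the
      point: since \<open>u i\<close> is at most 1 and m at most \<open>w i\<close>, all
      coefficients \<open>(1 + m) * w i - m * u i\<close> stay nonnegative.\<close>
    define m where "m = Min (w ` I)"
    have m: "0 < m" "\<And>i. i \<in> I \<Longrightarrow> m \<le> w i"
      unfolding m_def using assms(1) w(1) \<open>I \<noteq> {}\<close> by auto
    have "(1 - (1 + m)) *\<^sub>R x + (1 + m) *\<^sub>R ?z = (\<Sum>i\<in>I. ((1 + m) * w i - m * u i) *\<^sub>R p i)"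
      unfolding u(3) by (simp add: scaleR_sum_right scaleR_diff_left sum_subtractf sum_negf)
    also have "\<dots> \<in> ?S"
    proof (rule convex_sum[OF assms(1) convex_convex_hull])
      show "(\<Sum>i\<in>I. (1 + m) * w i - m * u i) = 1"
        using u(2) w(2) by (simp add: sum_subtractf sum_distrib_left[symmetric])
      fix i assume i: "i \<in> I"
      show "p i \<in> ?S" using i by (simp add: hull_inc)
      have "u i \<le> 1" using member_le_sum[OF i, of u] u assms(1) by simp
      then have "m * u i \<le> m * 1" using m(1) by (intro mult_left_mono) auto
      also have "m * 1 \<le> w i + m * w i" using m i w(1)[OF i] by (simp add: add_increasing2)
      finally show "0 \<le> (1 + m) * w i - m * u i" by (simp add: algebra_simps)
    qed
    finally show ?thesis using m(1) by (intro exI[of _ "1 + m"]) simp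
  qed
  moreover have "?S \<noteq> {}" using \<open>I \<noteq> {}\<close> by simp
  ultimately show ?thesis using convex_rel_interior_iff[OF convex_convex_hull, of "p ` I"] by blast
qed

text \<open>The kernel is the orthogonal complement of the row space.\<close>

lemma kernel_eq_of_row_space_eq:
  fixes A :: "real^'n^'k" and B :: "real^'n^'m"
  assumes "span (rows A) = span (rows B)" "B *v x = 0"
  shows "A *v x = 0"
proof -
  have "real_inner_class.orthogonal x y" if "y \<in> rows B" for y
  proof -
    from that obtain i where "y = B $ i" by (auto simp: Finite_Cartesian_Product.rows_def Finite_Cartesian_Product.row_def)
    moreover have "(B *v x) $ i = 0" using assms(2) by simp
    ultimately show ?thesis unfolding matrix_vector_mul_component real_inner_class.orthogonal_def by (simp add: inner_commute)
  qed
  then have "real_inner_class.orthogonal x y" if "y \<in> span (rows B)" for y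
    using orthogonal_to_span that by blast
  moreover have "A $ i \<in> span (rows A)" for i by (rule span_base) (auto simp: Finite_Cartesian_Product.rows_def Finite_Cartesian_Product.row_def)
  ultimately have "real_inner_class.orthogonal x (A $ i)" for i using assms(1) by blast
  then have "(A *v x) $ i = 0" for i
    unfolding matrix_vector_mul_component real_inner_class.orthogonal_def by (simp add: inner_commute)
  then show ?thesis by (simp add: Finite_Cartesian_Product.vec_eq_iff)
qed

section \<open>Points of the Lawrence polytope as weights on arcs\<close>

context lawrence_graph
begin

definition arc_point :: "('v, 'e) arc \<Rightarrow> real^('r + 'e)" where
  "arc_point a = (if a = ref (arc_edge a) then lawrence_pos M (arc_edge a) else lawrence_neg M (arc_edge a))"

lemma ref_arc: "e \<in> edges G \<Longrightarrow> ref e \<in> arcs G" "e \<in> edges G \<Longrightarrow> arc_edge (ref e) = e"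
  using ref unfolding reference_orientation_def by auto

lemma arc_point_ref:
  assumes "e \<in> edges G"
  shows "arc_point (ref e) = lawrence_pos M e" "arc_point (arc_rev (ref e)) = lawrence_neg M e"
  using ref_arc[OF assms] arc_rev_neq[of "ref e"] unfolding arc_point_def by auto

text \<open>\<open>simplex_fourientation\<close> records all Lawrence points lying in S. These
  include the vertices of S, and by convexity they span no more than S.\<close>

lemma simplex_eq_convex_hull:
  assumes "maximal_simplex G M S"
  shows "S = convex hull (arc_point ` simplex_fourientation G ref M S)"
proof -
  obtain C where C: "\<not> affine_dependent C" "S = convex hull C"
    using assms unfolding maximal_simplex_def simplex_def by blast
  have ext: "c \<in> lawrence_points G M" if "c \<in> C" for c
    using assms that extreme_point_of_convex_hull_affine_independent[OF C(1)]
    unfolding maximal_simplex_def C(2) by blast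
  have "C \<subseteq> arc_point ` simplex_fourientation G ref M S"
  proof
    fix c assume c: "c \<in> C"
    then have "c \<in> S" using C(2) hull_inc by metis
    from ext[OF c] consider e where "e \<in> edges G" "c = lawrence_pos M e" | e where "e \<in> edges G" "c = lawrence_neg M e"
      unfolding lawrence_points_def by blast
    then show "c \<in> arc_point ` simplex_fourientation G ref M S"
    proof cases
      case 1
      then show ?thesis using arc_point_ref \<open>c \<in> S\<close> unfolding simplex_fourientation_def
        by (intro image_eqI[of _ _ "ref e"]) auto
    next
      case 2
      then show ?thesis using arc_point_ref \<open>c \<in> S\<close> unfolding simplex_fourientation_def
        by (intro image_eqI[of _ _ "arc_rev (ref e)"]) auto
    qed
  qed
  moreover have "arc_point ` simplex_fourientation G ref M S \<subseteq> S"
    using arc_point_ref unfolding simplex_fourientation_def by auto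
  moreover have "convex S" using C(2) by (simp add: convex_convex_hull)
  ultimately show ?thesis using C(2) by (metis hull_minimal hull_mono subset_antisym)
qed

lemma sum_arcs: "(\<Sum>a\<in>arcs G. g a) = (\<Sum>e\<in>edges G. g (ref e) + g (arc_rev (ref e)))"
proof -
  have arcs: "arcs G = ref ` edges G \<union> (\<lambda>e. arc_rev (ref e)) ` edges G"
  proof (intro subset_antisym subsetI)
    fix a assume a: "a \<in> arcs G"
    then have e: "arc_edge a \<in> edges G" by (rule arc_edge_in_edges)
    then have "a = ref (arc_edge a) \<or> a = arc_rev (ref (arc_edge a))"
      using arc_same_edge[of "ref (arc_edge a)" a] ref_arc a by auto
    then show "a \<in> ref ` edges G \<union> (\<lambda>e. arc_rev (ref e)) ` edges G" using e by blast
  qed (use ref_arc in auto)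
  have disj: "ref ` edges G \<inter> (\<lambda>e. arc_rev (ref e)) ` edges G = {}"
  proof -
    have "ref e \<noteq> arc_rev (ref e')" if "e \<in> edges G" "e' \<in> edges G" for e e'
      using ref_arc that arc_rev_neq by (metis arc_rev_simps(1))
    then show ?thesis by blast
  qed
  have inj: "inj_on ref (edges G)" "inj_on (\<lambda>e. arc_rev (ref e)) (edges G)"
    using ref_arc(2) by (metis inj_onI) (metis (no_types, lifting) arc_rev_simps(1) inj_onI ref_arc(2))
  show ?thesis
    unfolding arcs sum.union_disjoint[OF finite finite disj] sum.reindex[OF inj(1)] sum.reindex[OF inj(2)] sum.distrib
    by (simp add: o_def)
qed

text \<open>Pairing the two arcs of an edge makes the \<open>Inr\<close> coordinates constant and
  turns the \<open>Inl\<close> coordinates into \<open>M *v x\<close>, with x the weights of the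
  reference arcs. The incidence matrix sends x to the inflow minus a constant depending only on
  \<open>ref\<close>. So equal inflows place the difference of the two vectors in its kernel, which
  is contained in that of \<open>M\<close>.\<close>

lemma weighted_arc_points_eq:
  assumes sum1: "\<And>a. a \<in> arcs G \<Longrightarrow> l a + l (arc_rev a) = (1::real)" "\<And>a. a \<in> arcs G \<Longrightarrow> l' a + l' (arc_rev a) = (1::real)"
    and flow: "\<And>v. (\<Sum>a\<in>arcs G. l a * of_bool (arc_head a = v)) = (\<Sum>a\<in>arcs G. l' a * of_bool (arc_head a = v))"
  shows "(\<Sum>a\<in>arcs G. l a *\<^sub>R arc_point a) = (\<Sum>a\<in>arcs G. l' a *\<^sub>R arc_point a)"
proof -
  let ?N = "incidence_matrix G ref"
  define x where "x k = (\<chi> e. if e \<in> edges G then k (ref e) else 0)" for k :: "('v, 'e) arc \<Rightarrow> real"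
  have N: "(?N *v x k) $ v = (\<Sum>a\<in>arcs G. k a * of_bool (arc_head a = v)) - (\<Sum>e\<in>edges G. of_bool (arc_tail (ref e) = v))"
    if "\<And>a. a \<in> arcs G \<Longrightarrow> k a + k (arc_rev a) = 1" for k v
  proof -
    have "(?N *v x k) $ v = (\<Sum>e\<in>UNIV. if e \<in> edges G then
        (of_bool (arc_head (ref e) = v) - of_bool (arc_tail (ref e) = v)) * k (ref e) else 0)"
      unfolding matrix_vector_mult_def by (auto simp: incidence_matrix_def x_def intro!: sum.cong)
    also have "\<dots> = (\<Sum>e\<in>edges G. (of_bool (arc_head (ref e) = v) - of_bool (arc_tail (ref e) = v)) * k (ref e))"
      by (simp add: sum.inter_restrict[symmetric])
    also have "\<dots> = (\<Sum>e\<in>edges G. k (ref e) * of_bool (arc_head (ref e) = v) +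
        k (arc_rev (ref e)) * of_bool (arc_head (arc_rev (ref e)) = v) - of_bool (arc_tail (ref e) = v))"
    proof (rule sum.cong[OF refl])
      fix e assume "e \<in> edges G"
      then have "k (arc_rev (ref e)) = 1 - k (ref e)" using that[of "ref e"] ref_arc by simp
      then show "(of_bool (arc_head (ref e) = v) - of_bool (arc_tail (ref e) = v)) * k (ref e) =
         k (ref e) * of_bool (arc_head (ref e) = v) +
        k (arc_rev (ref e)) * of_bool (arc_head (arc_rev (ref e)) = v) - of_bool (arc_tail (ref e) = v)"
        by (simp add: algebra_simps)
    qed
    finally show ?thesis unfolding sum_arcs sum_subtractf .
  qed
  have "?N *v x l = ?N *v x l'"
    by (simp only: Finite_Cartesian_Product.vec_eq_iff N[of l] N[of l'] sum1 flow simp_thms)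
  then have N0: "?N *v (x l - x l') = 0" by (simp add: matrix_vector_mult_diff_distrib)
  have "span (rows M) = span (rows ?N)" using lawrence unfolding lawrence_matrix_def by simp
  from kernel_eq_of_row_space_eq[OF this N0] have M: "M *v x l = M *v x l'"
    by (simp add: matrix_vector_mult_diff_distrib)
  have pts: "(\<Sum>a\<in>arcs G. k a *\<^sub>R arc_point a) =
      (\<chi> j. case j of Inl i \<Rightarrow> (M *v x k) $ i | Inr f \<Rightarrow> of_bool (f \<in> edges G))"
    if "\<And>a. a \<in> arcs G \<Longrightarrow> k a + k (arc_rev a) = 1" for k
  proof -
    have z: "(\<Sum>a\<in>arcs G. k a *\<^sub>R arc_point a) = (\<Sum>e\<in>edges G. k (ref e) *\<^sub>R lawrence_pos M e + (1 - k (ref e)) *\<^sub>R lawrence_neg M e)"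
      unfolding sum_arcs
    proof (rule sum.cong[OF refl])
      fix e assume e: "e \<in> edges G"
      then have "k (arc_rev (ref e)) = 1 - k (ref e)" using that[of "ref e"] ref_arc by simp
      then show "k (ref e) *\<^sub>R arc_point (ref e) + k (arc_rev (ref e)) *\<^sub>R arc_point (arc_rev (ref e)) =
        k (ref e) *\<^sub>R lawrence_pos M e + (1 - k (ref e)) *\<^sub>R lawrence_neg M e"
        by (simp add: arc_point_ref[OF e])
    qed
    have inl: "(\<Sum>a\<in>arcs G. k a *\<^sub>R arc_point a) $ Inl i = (M *v x k) $ i" for i
    proof -
      have "(\<Sum>a\<in>arcs G. k a *\<^sub>R arc_point a) $ Inl i = (\<Sum>e\<in>edges G. k (ref e) * M $ i $ e)"
        unfolding z by (simp add: lawrence_pos_def lawrence_neg_def)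
      also have "\<dots> = (\<Sum>e\<in>UNIV. if e \<in> edges G then k (ref e) * M $ i $ e else 0)"
        by (simp add: sum.inter_restrict[symmetric])
      also have "\<dots> = (M *v x k) $ i"
        unfolding matrix_vector_mult_def x_def by (auto intro!: sum.cong)
      finally show ?thesis .
    qed
    have inr: "(\<Sum>a\<in>arcs G. k a *\<^sub>R arc_point a) $ Inr f = of_bool (f \<in> edges G)" for f
    proof -
      have "(\<Sum>a\<in>arcs G. k a *\<^sub>R arc_point a) $ Inr f = (\<Sum>e\<in>edges G. if e = f then 1 else 0)"
        unfolding z by (simp add: lawrence_pos_def lawrence_neg_def distrib_right[symmetric] eq_commute[of f])
      then show ?thesis by (simp add: sum.delta)
    qed
    show ?thesis
      unfolding Finite_Cartesian_Product.vec_eq_iff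
    proof
      fix j :: "'r + 'e"
      show "(\<Sum>a\<in>arcs G. k a *\<^sub>R arc_point a) $ j =
        (\<chi> j. case j of Inl i \<Rightarrow> (M *v x k) $ i | Inr f \<Rightarrow> of_bool (f \<in> edges G)) $ j"
        by (cases j) (simp_all only: inl inr vec_lambda_beta sum.case)
    qed
  qed
  show ?thesis by (simp only: pts[of l] pts[of l'] sum1 M)
qed

lemma card_arcs_sum:
  assumes "\<And>a. a \<in> arcs G \<Longrightarrow> l a + l (arc_rev a) = (1::real)"
  shows "(\<Sum>a\<in>arcs G. l a) = real (card (edges G))"
  unfolding sum_arcs using assms ref_arc(1) by simp

end

context lawrence_graph
begin

text \<open>
  Arc weights with \<open>l a + l (arc_rev a) = 1\<close> are the points of the fibre of the Lawrence polytope over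
  the barycentre (scaled by the number of edges); the indicator of the orientation \<open>F\<close> is a vertex of
  the cell of each tree, and it is pushed into the interior by moving weight \<open>c a\<close> from \<open>a\<close> to its
  reversal for the arcs \<open>a\<close> in \<open>S\<close>.
\<close>

definition perturbation ::
    "('v, 'e) arc set \<Rightarrow> ('v, 'e) arc set \<Rightarrow> (('v, 'e) arc \<Rightarrow> real) \<Rightarrow> ('v, 'e) arc \<Rightarrow> real" where
  "perturbation F S c a = of_bool (a \<in> F) - of_bool (a \<in> S) * c a + of_bool (arc_rev a \<in> S) * c (arc_rev a)"

lemma perturbation_sum1:
  assumes "orientation_of G (edges G) F" "a \<in> arcs G"
  shows "perturbation F S c a + perturbation F S c (arc_rev a) = 1"
  using orientation_ofD(5)[OF assms(1) assms(2)] arc_edge_in_edges[OF assms(2)]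
  unfolding perturbation_def by auto

lemma perturbation_flow:
  assumes "orientation_of G (edges G) F" "S \<subseteq> F"
  shows "(\<Sum>a\<in>arcs G. perturbation F S c a * of_bool (arc_head a = v)) = real_of_int (break_div F v)
    - (\<Sum>a\<in>S. c a * (of_bool (arc_head a = v) - of_bool (arc_tail a = v)))"
proof -
  have FA: "F \<subseteq> arcs G" using orientation_ofD(1)[OF assms(1)] .
  then have SA: "S \<subseteq> arcs G" using assms(2) by blast
  let ?h = "\<lambda>a. of_bool (arc_head a = v) :: real"
  have "(\<Sum>a\<in>arcs G. perturbation F S c a * ?h a) =
      (\<Sum>a\<in>arcs G. if a \<in> F then ?h a else 0) - (\<Sum>a\<in>arcs G. if a \<in> S then c a * ?h a else 0)
      + (\<Sum>a\<in>arcs G. if arc_rev a \<in> S then c (arc_rev a) * ?h a else 0)"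
    unfolding sum.distrib[symmetric] sum_subtractf[symmetric] perturbation_def
    by (intro sum.cong) (auto simp: algebra_simps)
  also have "(\<Sum>a\<in>arcs G. if a \<in> F then ?h a else 0) = real_of_int (break_div F v)"
  proof -
    have "(\<Sum>a\<in>arcs G. if a \<in> F then ?h a else 0) = (\<Sum>a\<in>F. ?h a)"
      using FA by (simp add: sum.inter_restrict[symmetric] Int_absorb1)
    also have "\<dots> = real (card {a \<in> F. arc_head a = v})" by (simp add: sum_of_bool_eq Collect_conj_eq)
    finally show ?thesis unfolding break_div_def by simp
  qed
  also have "(\<Sum>a\<in>arcs G. if a \<in> S then c a * ?h a else 0) = (\<Sum>a\<in>S. c a * ?h a)"
    using SA by (simp add: sum.inter_restrict[symmetric] Int_absorb1)
  also have "(\<Sum>a\<in>arcs G. if arc_rev a \<in> S then c (arc_rev a) * ?h a else 0)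
      = (\<Sum>a\<in>S. c a * of_bool (arc_tail a = v))"
  proof -
    have r: "arc_rev ` arcs G = arcs G" by (intro subset_antisym subsetI) simp_all
    have "(\<Sum>a\<in>arc_rev ` arcs G. if a \<in> S then c a * of_bool (arc_tail a = v) else 0)
       = (\<Sum>a\<in>arcs G. if arc_rev a \<in> S then c (arc_rev a) * ?h a else 0)"
      unfolding sum.reindex[OF inj_arc_rev] o_def by (intro sum.cong) auto
    then have "(\<Sum>a\<in>arcs G. if arc_rev a \<in> S then c (arc_rev a) * ?h a else 0) =
        (\<Sum>a\<in>arcs G. if a \<in> S then c a * of_bool (arc_tail a = v) else 0)" unfolding r by simp
    also have "\<dots> = (\<Sum>a\<in>S. c a * of_bool (arc_tail a = v))"
      using SA by (simp add: sum.inter_restrict[symmetric] Int_absorb1)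
    finally show ?thesis .
  qed
  finally show ?thesis by (simp add: sum_subtractf right_diff_distrib)
qed

text \<open>The two arcs of a tree edge receive c and 1 - c, the arc of X over any other edge
  receives 1, and arcs outside X receive 0. So the weights are positive exactly on X; their sum is
  the number of edges, whence the normalization.\<close>

lemma perturbed_point_in_rel_interior:
  assumes S: "maximal_simplex G M S" and X: "simplex_fourientation G ref M S = X"
    and ext: "externally_oriented G T X" and T: "T \<in> spanning_trees G" and \<sigma>: "cocycle_signature G \<sigma>"
    and n: "edges G \<noteq> {}"
    and c: "\<And>a. a \<in> arcs G \<Longrightarrow> 0 < c a \<and> c a < 1"
  defines "F \<equiv> X \<inter> internal_atlas_of G \<sigma> T"
  shows "(\<Sum>a\<in>arcs G. perturbation F {a \<in> F. arc_edge a \<in> T} c a *\<^sub>R arc_point a) /\<^sub>R card (edges G)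
    \<in> rel_interior S"
proof -
  let ?l = "perturbation F {a \<in> F. arc_edge a \<in> T} c"
  let ?n = "real (card (edges G))"
  have O: "orientation_of G (edges G) F" unfolding F_def by (rule orientation_tree_pair[OF \<sigma> T ext])
  have XA: "X \<subseteq> arcs G" using ext unfolding externally_oriented_def fourientation_def by blast
  have n0: "?n > 0" using n by (simp add: card_gt_0_iff)
  have tree: "a \<in> X" if "a \<in> arcs G" "arc_edge a \<in> T" for a
    using ext that unfolding externally_oriented_def bioriented_def by blast
  have zero: "?l a = 0" if a: "a \<in> arcs G - X" for a
  proof -
    have "arc_edge a \<notin> T" "a \<notin> F" using a tree unfolding F_def by blast+
    then show ?thesis unfolding perturbation_def by simp
  qed
  have pos: "0 < ?l a" if a: "a \<in> X" for a
  proof (cases "arc_edge a \<in> T")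
    case True
    have aA: "a \<in> arcs G" using a XA by blast
    then have rev: "arc_rev a \<in> F \<longleftrightarrow> a \<notin> F" using orientation_ofD(5)[OF O aA] arc_edge_in_edges by blast
    show ?thesis using True rev c[OF aA] c[of "arc_rev a"] aA unfolding perturbation_def by (cases "a \<in> F") auto
  next
    case False
    then have "a \<in> F" using internal_atlas_off_tree[of a T \<sigma>] a XA unfolding F_def by blast
    then show ?thesis using False unfolding perturbation_def by simp
  qed
  have restrict: "(\<Sum>a\<in>arcs G. ?l a *\<^sub>R g a) = (\<Sum>a\<in>X. ?l a *\<^sub>R g a)" for g :: "('v, 'e) arc \<Rightarrow> 'w::real_vector"
    by (rule sum.mono_neutral_right) (use XA zero in auto)
  have "(\<Sum>a\<in>X. (?l a / ?n) *\<^sub>R arc_point a) \<in> rel_interior (convex hull (arc_point ` X))"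
  proof (rule positive_combination_in_rel_interior)
    show "0 < ?l a / ?n" if "a \<in> X" for a using pos[OF that] n0 by simp
    have "(\<Sum>a\<in>X. ?l a) = ?n"
      using restrict[of "\<lambda>_. 1 :: real"] card_arcs_sum[of ?l] perturbation_sum1[OF O] by simp
    then show "(\<Sum>a\<in>X. ?l a / ?n) = 1" using n n0 by (simp add: sum_divide_distrib[symmetric])
  qed simp
  also have "convex hull (arc_point ` X) = S" using simplex_eq_convex_hull[OF S] unfolding X by simp
  also have "(\<Sum>a\<in>X. (?l a / ?n) *\<^sub>R arc_point a) = (\<Sum>a\<in>X. ?l a *\<^sub>R arc_point a) /\<^sub>R card (edges G)"
    by (simp add: scaleR_sum_right divide_inverse mult.commute)
  finally show ?thesis unfolding restrict .
qed

lemma externally_oriented_tree_unique: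
  assumes "externally_oriented G T X" "externally_oriented G T' X"
    and "T \<in> spanning_trees G" "T' \<in> spanning_trees G"
  shows "T = T'"
proof -
  have "T \<subseteq> T'" if T: "T \<in> spanning_trees G" and E: "externally_oriented G T X" "externally_oriented G T' X" for T T'
  proof
    fix e assume "e \<in> T"
    then have e: "e \<in> edges G" using spanning_tree_subset[OF T] by blast
    then obtain a where a: "a \<in> arcs G" "arc_edge a = e" using ex_arc by blast
    then have "a \<in> X" "arc_rev a \<in> X"
      using E(1) \<open>e \<in> T\<close> unfolding externally_oriented_def bioriented_def by auto
    then have "\<not> one_way X e" using arc_rev_neq[OF a(1)] a(2) unfolding one_way_def by (metis arc_rev_simps(1))
    then show "e \<in> T'" using E(2) e unfolding externally_oriented_def by blast
  qed
  from this[OF assms(3,1,2)] this[OF assms(4,2,1)] show ?thesis by blast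
qed

lemma tree_pair_divisor_inj:
  assumes \<sigma>: "cocycle_signature G \<sigma>" "triangulating G \<sigma>"
    and A: "external_atlas G A" "dissecting G ref M A"
    and T: "T1 \<in> spanning_trees G" "T2 \<in> spanning_trees G"
    and eq: "break_div (A T1 \<inter> internal_atlas_of G \<sigma> T1) = break_div (A T2 \<inter> internal_atlas_of G \<sigma> T2)"
  shows "T1 = T2"
proof (rule ccontr)
  assume "T1 \<noteq> T2"
  \<comment> \<open>Ensures that dividing by the number of edges normalizes the weights.\<close>
  then have ne: "edges G \<noteq> {}" using spanning_tree_subset T by blast
  have ext: "externally_oriented G T (A T)" if "T \<in> spanning_trees G" for T
    using A(1) that unfolding external_atlas_def by blast
  define F where "F T = A T \<inter> internal_atlas_of G \<sigma> T" for T
  define S where "S T = {a \<in> F T. arc_edge a \<in> T}" for T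
  have O: "orientation_of G (edges G) (F T)" if "T \<in> spanning_trees G" for T
    unfolding F_def using orientation_tree_pair[OF \<sigma>(1) that ext[OF that]] .
  have SF: "S T \<subseteq> F T" for T unfolding S_def by blast
  have cut: "a \<in> internal_atlas_of G \<sigma> T"
    if T: "T \<in> spanning_trees G" and a: "a \<in> arcs G" "arc_rev a \<notin> S T" for T a
  proof (cases "arc_edge a \<in> T")
    case True
    then have "a \<in> F T" using orientation_ofD(5)[OF O[OF T] a(1)] arc_edge_in_edges[OF a(1)] a(2) unfolding S_def by auto
    then show ?thesis unfolding F_def by blast
  qed (rule internal_atlas_off_tree[OF a(1)])
  \<comment> \<open>An \<open>Inl\<close> arc is traversed forwards, an \<open>Inr\<close> arc
    backwards; the disjoint sum keeps the two uses apart when the same arc belongs to both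
    trees.\<close>
  define t h where "t = case_sum (arc_tail :: ('v, 'e) arc \<Rightarrow> 'v) (arc_head :: ('v, 'e) arc \<Rightarrow> 'v)"
    and "h = case_sum (arc_head :: ('v, 'e) arc \<Rightarrow> 'v) (arc_tail :: ('v, 'e) arc \<Rightarrow> 'v)"
  \<comment> \<open>Without an exit, no tree arc of T1 leaves W and no tree arc of T2 enters W. Then
    the internal version of T1 contains all arcs into W and that of T2 all arcs out of W.\<close>
  have "\<exists>i\<in>S T1 <+> S T2. t i \<in> W \<and> h i \<notin> W" if W: "W \<noteq> {}" "W \<noteq> UNIV" for W
  proof (rule ccontr)
    assume no: "\<not> ?thesis"
    have no1: "\<not> (arc_tail a \<in> W \<and> arc_head a \<notin> W)" if "a \<in> S T1" for a
      using no that unfolding t_def h_def by force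
    have no2: "\<not> (arc_head a \<in> W \<and> arc_tail a \<notin> W)" if "a \<in> S T2" for a
      using no that unfolding t_def h_def by force
    have "cut_in G W \<subseteq> internal_atlas_of G \<sigma> T1"
      using cut[OF T(1)] no1 unfolding cut_in_def by fastforce
    moreover have "arc_rev ` cut_in G W \<subseteq> internal_atlas_of G \<sigma> T2"
    proof
      fix a assume "a \<in> arc_rev ` cut_in G W"
      then have a: "a \<in> arcs G" "arc_rev a \<in> cut_in G W" by (auto simp: cut_in_def)
      then show "a \<in> internal_atlas_of G \<sigma> T2" using cut[OF T(2) a(1)] no2[of "arc_rev a"] unfolding cut_in_def by auto
    qed
    ultimately show False using no_opposite_cuts[OF \<sigma>(2) T W] by blast
  qed
  then obtain c :: "('v, 'e) arc + ('v, 'e) arc \<Rightarrow> real" where c: "\<forall>i\<in>S T1 <+> S T2. 0 < c i"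
    and circ: "\<forall>v. (\<Sum>i\<in>S T1 <+> S T2. c i * (of_bool (h i = v) - of_bool (t i = v))) = 0"
    using positive_circulation[of "S T1 <+> S T2" t h] by auto
  \<comment> \<open>Scaling preserves circulations; the summand 1 keeps b positive and every
    \<open>c i / b\<close> strictly below 1.\<close>
  define b where "b = 1 + (\<Sum>i\<in>S T1 <+> S T2. c i)"
  have b: "0 < b" "\<And>i. i \<in> S T1 <+> S T2 \<Longrightarrow> c i < b"
  proof -
    have fin: "finite (S T1 <+> S T2)" by simp
    have "0 \<le> (\<Sum>i\<in>S T1 <+> S T2. c i)" using c by (intro sum_nonneg) (simp add: less_imp_le)
    then show "0 < b" unfolding b_def by simp
    fix i assume i: "i \<in> S T1 <+> S T2"
    have "c i \<le> (\<Sum>i\<in>S T1 <+> S T2. c i)" by (rule member_le_sum[OF i _ fin]) (use c in \<open>auto simp: less_imp_le\<close>)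
    then show "c i < b" unfolding b_def by simp
  qed
  \<comment> \<open>Only the values on \<open>S T1\<close> enter the perturbation; 1 / 2 is a filler
    strictly between 0 and 1 for the remaining arcs.\<close>
  define c1 where "c1 a = (if a \<in> S T1 then c (Inl a) / b else 1 / 2)" for a
  define c2 where "c2 a = (if a \<in> S T2 then c (Inr a) / b else 1 / 2)" for a
  have c12: "0 < c1 a \<and> c1 a < 1" "0 < c2 a \<and> c2 a < 1" for a
  proof -
    have frac: "0 < c i / b \<and> c i / b < 1" if "i \<in> S T1 <+> S T2" for i
      using c b(1) b(2)[OF that] that by simp
    show "0 < c1 a \<and> c1 a < 1"
      using frac[OF InlI, of a] unfolding c1_def by (cases "a \<in> S T1") simp_all
    show "0 < c2 a \<and> c2 a < 1"
      using frac[OF InrI, of a] unfolding c2_def by (cases "a \<in> S T2") simp_all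
  qed
  \<comment> \<open>The circulation runs backwards on the arcs of T2, so its vanishing boundary says
    that the two trees contribute the same net flow.\<close>
  have flow: "(\<Sum>a\<in>S T1. c1 a * (of_bool (arc_head a = v) - of_bool (arc_tail a = v)))
     = (\<Sum>a\<in>S T2. c2 a * (of_bool (arc_head a = v) - of_bool (arc_tail a = v)))" for v
  proof -
    have "(\<Sum>a\<in>S T1. c (Inl a) * (of_bool (arc_head a = v) - of_bool (arc_tail a = v)))
        + (\<Sum>a\<in>S T2. c (Inr a) * (of_bool (arc_tail a = v) - of_bool (arc_head a = v))) = 0"
      using circ[rule_format, of v] by (simp add: sum.Plus t_def h_def o_def)
    moreover have "(\<Sum>a\<in>S T2. c (Inr a) * (of_bool (arc_tail a = v) - of_bool (arc_head a = v)))
       = - (\<Sum>a\<in>S T2. c (Inr a) * (of_bool (arc_head a = v) - of_bool (arc_tail a = v)))"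
      unfolding sum_negf[symmetric] by (intro sum.cong) (auto simp: algebra_simps)
    ultimately have "(\<Sum>a\<in>S T1. c (Inl a) * (of_bool (arc_head a = v) - of_bool (arc_tail a = v)))
        = (\<Sum>a\<in>S T2. c (Inr a) * (of_bool (arc_head a = v) - of_bool (arc_tail a = v)))" by linarith
    then have "(\<Sum>a\<in>S T1. c (Inl a) * (of_bool (arc_head a = v) - of_bool (arc_tail a = v))) / b
        = (\<Sum>a\<in>S T2. c (Inr a) * (of_bool (arc_head a = v) - of_bool (arc_tail a = v))) / b" by simp
    then show ?thesis unfolding sum_divide_distrib c1_def c2_def by (simp cong: sum.cong)
  qed
  define z where "z T c = (\<Sum>a\<in>arcs G. perturbation (F T) (S T) c a *\<^sub>R arc_point a)" for T c
  \<comment> \<open>The starting orientations have equal indegrees and the moved weights equal net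
    flows, so the perturbed weights have equal inflows.\<close>
  have z: "z T1 c1 = z T2 c2"
    unfolding z_def
  proof (rule weighted_arc_points_eq)
    show "(\<Sum>a\<in>arcs G. perturbation (F T1) (S T1) c1 a * of_bool (arc_head a = v)) =
      (\<Sum>a\<in>arcs G. perturbation (F T2) (S T2) c2 a * of_bool (arc_head a = v))" for v
      unfolding perturbation_flow[OF O[OF T(1)] SF] perturbation_flow[OF O[OF T(2)] SF] flow
      using eq unfolding F_def by simp
  qed (rule perturbation_sum1[OF O[OF T(1)]] perturbation_sum1[OF O[OF T(2)]], assumption)+
  obtain \<Delta> where \<Delta>: "dissection G M \<Delta>" "A ` spanning_trees G = simplex_fourientation G ref M ` \<Delta>"
    using A(2) unfolding dissecting_def by blast
  obtain S1 S2 where S12: "S1 \<in> \<Delta>" "simplex_fourientation G ref M S1 = A T1"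
      "S2 \<in> \<Delta>" "simplex_fourientation G ref M S2 = A T2"
  proof -
    have "A T1 \<in> simplex_fourientation G ref M ` \<Delta>" "A T2 \<in> simplex_fourientation G ref M ` \<Delta>"
      unfolding \<Delta>(2)[symmetric] using T by (auto intro: imageI)
    then show thesis using that by (elim imageE) simp
  qed
  have dissect: "\<forall>S\<in>\<Delta>. maximal_simplex G M S" "pairwise (\<lambda>S S'. rel_interior S \<inter> rel_interior S' = {}) \<Delta>"
    using \<Delta>(1) unfolding dissection_def by simp_all
  have max: "maximal_simplex G M S1" "maximal_simplex G M S2" using dissect(1) S12(1,3) by simp_all
  have "z T1 c1 /\<^sub>R card (edges G) \<in> rel_interior S1"
    using perturbed_point_in_rel_interior[OF max(1) S12(2) ext[OF T(1)] T(1) \<sigma>(1) ne c12(1)]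
    unfolding z_def S_def F_def .
  moreover have "z T1 c1 /\<^sub>R card (edges G) \<in> rel_interior S2"
    using perturbed_point_in_rel_interior[OF max(2) S12(4) ext[OF T(2)] T(2) \<sigma>(1) ne c12(2)]
    unfolding z unfolding z_def S_def F_def .
  ultimately have "S1 = S2"
    using pairwiseD[OF dissect(2) S12(1,3)] by blast
  then have "A T1 = A T2" using S12 by simp
  then show False using externally_oriented_tree_unique[of T1 "A T1" T2] ext[OF T(1)] ext[OF T(2)] T \<open>T1 \<noteq> T2\<close> by simp
qed

end

section \<open>The divisors of the tree pairs as chip-firing representatives\<close>

theorem theorem5p1:
  fixes G :: "('v::finite, 'e::finite) multigraph"
    and q :: 'v
    and ref :: "'e \<Rightarrow> ('v, 'e) arc"
    and R :: "'r::finite set"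
    and M :: "real^'e^'r"
    and A :: "'e set \<Rightarrow> ('v, 'e) arc set"
    and \<sigma> :: "'e set \<Rightarrow> ('v, 'e) arc set"
  assumes "loopless G" and "connected_graph G"
    and "reference_orientation G ref" and "lawrence_matrix G ref R M"
    and "external_atlas G A" and "dissecting G ref M A"
    and "cocycle_signature G \<sigma>" and "triangulating G \<sigma>"
  defines "D \<equiv> \<lambda>T. fourientation_div (A T \<inter> internal_atlas_of G \<sigma> T) \<oplus>\<^sub>D chip q"
  shows "(\<forall>T\<in>spanning_trees G. I_sig G q \<sigma> T \<in> Div 0) \<and>
    (\<forall>T\<in>spanning_trees G. \<forall>T'\<in>spanning_trees G.
       T \<noteq> T' \<longrightarrow> \<not> linearly_equivalent G (D T) (D T')) \<and>
    D ` spanning_trees G = BD G (I_sig G q \<sigma>) \<and>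
    complete_representatives G (genus G) (BD G (I_sig G q \<sigma>))"
proof -
  interpret lawrence_graph G ref R M
    using assms by unfold_locales
  note \<sigma> = \<open>cocycle_signature G \<sigma>\<close> \<open>triangulating G \<sigma>\<close>
  have O: "orientation_of G (edges G) (A T \<inter> internal_atlas_of G \<sigma> T)" if "T \<in> spanning_trees G" for T
    using orientation_tree_pair[OF \<sigma>(1) that] assms(5) that unfolding external_atlas_def by blast
  have D: "D T = (\<lambda>v. break_div (A T \<inter> internal_atlas_of G \<sigma> T) v - 1 + chip q v)" if "T \<in> spanning_trees G" for T
    unfolding D_def by (rule fourientation_div_orientation[OF O[OF that]])
  have D_BD: "D T \<in> BD G (I_sig G q \<sigma>)" if "T \<in> spanning_trees G" for T
    unfolding BD_iff[OF \<sigma>(1)] using O[OF that] D[OF that] that by blast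
  \<comment> \<open>Within \<open>BD\<close> equivalent divisors are equal; cancelling the common
    term \<open>chip q\<close> and the constant -1 leaves equal indegrees, which determine the
    tree.\<close>
  have ineq: "T = T'" if T: "T \<in> spanning_trees G" "T' \<in> spanning_trees G" "linearly_equivalent G (D T) (D T')" for T T'
  proof -
    have "D T = D T'" using BD_equivalent_eq[OF \<sigma> D_BD[OF T(1)] D_BD[OF T(2)] T(3)] .
    then have "break_div (A T \<inter> internal_atlas_of G \<sigma> T) v = break_div (A T' \<inter> internal_atlas_of G \<sigma> T') v" for v
      using fun_cong[of "D T" "D T'" v] unfolding D[OF T(1)] D[OF T(2)] by simp
    then show ?thesis using tree_pair_divisor_inj[OF \<sigma> assms(5,6) T(1,2)] by blast
  qed
  have complete: "\<exists>T\<in>spanning_trees G. linearly_equivalent G E (D T)" if "E \<in> Div (genus G)" for E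
    using inequivalent_family_complete[OF BD_degree[OF \<sigma>(1) D_BD] ineq that] .
  have BD: "D ` spanning_trees G = BD G (I_sig G q \<sigma>)"
  proof (intro subset_antisym subsetI)
    fix E assume E: "E \<in> BD G (I_sig G q \<sigma>)"
    obtain T where T: "T \<in> spanning_trees G" "linearly_equivalent G E (D T)"
      using complete BD_degree[OF \<sigma>(1) E] by blast
    then have "E = D T" using BD_equivalent_eq[OF \<sigma> E D_BD] by blast
    then show "E \<in> D ` spanning_trees G" using T by blast
  qed (use D_BD in blast)
  have "complete_representatives G (genus G) (BD G (I_sig G q \<sigma>))"
    unfolding complete_representatives_def
  proof (intro conjI ballI)
    show "BD G (I_sig G q \<sigma>) \<subseteq> Div (genus G)" using BD_degree[OF \<sigma>(1)] by blast
    fix E :: "'v divisor" assume "E \<in> Div (genus G)"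
    then obtain T where T: "T \<in> spanning_trees G" "linearly_equivalent G E (D T)" using complete by blast
    show "\<exists>!D'. D' \<in> BD G (I_sig G q \<sigma>) \<and> linearly_equivalent G E D'"
    proof (rule ex1I[of _ "D T"])
      show "D T \<in> BD G (I_sig G q \<sigma>) \<and> linearly_equivalent G E (D T)" using T D_BD by blast
      fix D' assume D': "D' \<in> BD G (I_sig G q \<sigma>) \<and> linearly_equivalent G E D'"
      then have "linearly_equivalent G D' (D T)"
        using T(2) linearly_equivalent_sym linearly_equivalent_trans by blast
      then show "D' = D T" using BD_equivalent_eq[OF \<sigma> _ D_BD[OF T(1)]] D' by blast
    qed
  qed
  then show ?thesis using I_sig_Div0[OF \<sigma>(1)] ineq BD by blast
qed

end
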